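(* For an integer $n\geq 5$, the following hold in the Mutual Failures Variant: \begin{itemize} \item $P_n>\bigstar$, and \item $\text{AW}(P_n)\geq 1$. \end{itemize}
   Context: The Mutual Failures Variant of the Mixed Deletion Game is a partisan combinatorial game played on a finite simple undirected graph by two players, Left and Right, who alternate turns. On her turn Left deletes one vertex together with all its incident edges; on his turn Right deletes one edge. A deletion that would create an isolated vertex ends the game and the player who made it loses (so such deletions are effectively unavailable). In addition, the Mutual Failures Variant imposes the condition that in any graph position Right has no available move if and only if Left has no available move; hence every position is all-small. $P_n$ denotes the game position on the path graph with $n$ vertices. $\bigstar$ denotes far star (a sufficiently large nim heap), $\uparrow=\{0\mid\ast\}$, $\downarrow=\{\ast\mid 0\}$, and $\ast=\{0\mid 0\}$. Two positions $G,H$ are far star equivalent if $G+X+\bigstar$ and $H+X+\bigstar$ have the same outcome for every position $X$; equivalently ${\downarrow}{\bigstar}<G-H<{\uparrow}{\bigstar}$. The atomic weight $\text{AW}(G)$ of $G$ is the integer $n$ such that $G$ is far star equivalent to $n\cdot\uparrow$. *)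

theory Defs
  imports Complex_Main "HOL-Library.FSet"
begin

section \<open>Short partizan games\<close>

datatype game = Game (left_opts: "game fset") (right_opts: "game fset")

lemma size_less_size_fset:
  assumes "g |\<in>| L"
  shows "size g < size_fset size L"
proof -
  have "Suc (size g) \<le> (\<Sum>x\<in>fset L. Suc (size x))"
    using assms by (intro member_le_sum) auto
  then show ?thesis
    by (simp add: size_fset_simps)
qed

lemma size_left_opts [termination_simp]: "g |\<in>| left_opts G \<Longrightarrow> size g < size G"
  by (cases G) (auto dest: size_less_size_fset)

lemma size_right_opts [termination_simp]: "g |\<in>| right_opts G \<Longrightarrow> size g < size G"
  by (cases G) (auto dest: size_less_size_fset)

datatype player = Left | Right

fun opponent :: "player \<Rightarrow> player" where
  "opponent Left = Right"
| "opponent Right = Left"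

fun opts :: "player \<Rightarrow> game \<Rightarrow> game fset" where
  "opts Left G = left_opts G"
| "opts Right G = right_opts G"

lemma size_opts [termination_simp]: "g |\<in>| opts p G \<Longrightarrow> size g < size G"
  by (cases p) (auto simp: termination_simp)

text \<open>Normal play: a player who is to move and has no option loses.\<close>

fun wins_first :: "player \<Rightarrow> game \<Rightarrow> bool" where
  "wins_first p G \<longleftrightarrow> (\<exists>g\<in>fset (opts p G). \<not> wins_first (opponent p) g)"

text \<open>The outcome class of a game is determined by who wins when Left starts and who wins
  when Right starts.\<close>

definition same_outcome :: "game \<Rightarrow> game \<Rightarrow> bool" where
  "same_outcome G H \<longleftrightarrow> (\<forall>p. wins_first p G = wins_first p H)"

instantiation game :: "{zero, plus, uminus, minus, ord}"
begin

definition zero_game :: game where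
  "0 = Game {||} {||}"

function plus_game :: "game \<Rightarrow> game \<Rightarrow> game" where
  "plus_game G H = Game
     ((\<lambda>g. plus_game g H) |`| left_opts G |\<union>| (\<lambda>h. plus_game G h) |`| left_opts H)
     ((\<lambda>g. plus_game g H) |`| right_opts G |\<union>| (\<lambda>h. plus_game G h) |`| right_opts H)"
  by pat_completeness auto
termination
  by (relation "measure (\<lambda>(G, H). size G + size H)") (auto simp: termination_simp)

primrec uminus_game :: "game \<Rightarrow> game" where
  "uminus_game (Game L R) = Game (uminus_game |`| R) (uminus_game |`| L)"

definition minus_game :: "game \<Rightarrow> game \<Rightarrow> game" where
  "G - H = G + (- H :: game)"

definition less_eq_game :: "game \<Rightarrow> game \<Rightarrow> bool" where
  "G \<le> H \<longleftrightarrow> \<not> wins_first Right (H - G)"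

definition less_game :: "game \<Rightarrow> game \<Rightarrow> bool" where
  "G < H \<longleftrightarrow> G \<le> H \<and> \<not> H \<le> (G :: game)"

instance ..

end

declare wins_first.simps [simp del] plus_game.simps [simp del]

text \<open>Equality on type \<open>game\<close> is identity of game trees, not equality of values; all notions
  below depend on games only through outcomes of sums and the order.\<close>

lemma fset_of_list_upt_less [termination_simp]: "i |\<in>| fset_of_list [0..<m] \<Longrightarrow> i < m"
  by (simp add: fset_of_list_elem)

fun nim :: "nat \<Rightarrow> game" where
  "nim m = Game (nim |`| fset_of_list [0..<m]) (nim |`| fset_of_list [0..<m])"

declare nim.simps [simp del]

definition star :: game where
  "star = Game {|0|} {|0|}"

definition up :: game where
  "up = Game {|0|} {|star|}"

primrec nat_mult :: "nat \<Rightarrow> game \<Rightarrow> game" where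
  "nat_mult 0 G = 0"
| "nat_mult (Suc k) G = G + nat_mult k G"

definition int_mult :: "int \<Rightarrow> game \<Rightarrow> game" where
  "int_mult k G = (if 0 \<le> k then nat_mult (nat k) G else nat_mult (nat (- k)) (- G))"


section \<open>Far star and atomic weight\<close>

text \<open>The far star is a sufficiently large nim heap, so that statements about it are statements
  about all sufficiently large nim heaps.\<close>

definition greater_far_star :: "game \<Rightarrow> bool" where
  "greater_far_star G \<longleftrightarrow> (\<forall>\<^sub>F m in sequentially. nim m < G)"

definition far_star_equivalent :: "game \<Rightarrow> game \<Rightarrow> bool" where
  "far_star_equivalent G H \<longleftrightarrow>
     (\<forall>X. \<forall>\<^sub>F m in sequentially. same_outcome (G + X + nim m) (H + X + nim m))"

definition has_atomic_weight :: "game \<Rightarrow> int \<Rightarrow> bool" where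
  "has_atomic_weight G k \<longleftrightarrow> far_star_equivalent G (int_mult k up)"

definition atomic_weight :: "game \<Rightarrow> int" where
  "atomic_weight G = (THE k. has_atomic_weight G k)"


section \<open>The Mixed Deletion Game\<close>

text \<open>Edges are two-element sets of vertices.\<close>

datatype 'a graph = Graph (verts: "'a fset") (edges: "'a fset fset")

definition simple_graph :: "'a graph \<Rightarrow> bool" where
  "simple_graph G \<longleftrightarrow> (\<forall>e. e |\<in>| edges G \<longrightarrow> e |\<subseteq>| verts G \<and> fcard e = 2)"

definition delete_vertex :: "'a graph \<Rightarrow> 'a \<Rightarrow> 'a graph" where
  "delete_vertex G v = Graph (verts G |-| {|v|}) (ffilter (\<lambda>e. v |\<notin>| e) (edges G))"

definition delete_edge :: "'a graph \<Rightarrow> 'a fset \<Rightarrow> 'a graph" where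
  "delete_edge G e = Graph (verts G) (edges G |-| {|e|})"

definition isolated :: "'a graph \<Rightarrow> 'a \<Rightarrow> bool" where
  "isolated G v \<longleftrightarrow> v |\<in>| verts G \<and> (\<forall>e. e |\<in>| edges G \<longrightarrow> v |\<notin>| e)"

definition creates_isolated :: "'a graph \<Rightarrow> 'a graph \<Rightarrow> bool" where
  "creates_isolated G H \<longleftrightarrow> (\<exists>v. isolated H v \<and> \<not> isolated G v)"

definition left_safe :: "'a graph \<Rightarrow> 'a \<Rightarrow> bool" where
  "left_safe G v \<longleftrightarrow> v |\<in>| verts G \<and> \<not> creates_isolated G (delete_vertex G v)"

definition right_safe :: "'a graph \<Rightarrow> 'a fset \<Rightarrow> bool" where
  "right_safe G e \<longleftrightarrow> e |\<in>| edges G \<and> \<not> creates_isolated G (delete_edge G e)"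

definition connected_to :: "'a graph \<Rightarrow> 'a \<Rightarrow> 'a \<Rightarrow> bool" where
  "connected_to G v w \<longleftrightarrow> (v, w) \<in> {(x, y). {|x, y|} |\<in>| edges G}\<^sup>*"

definition component :: "'a graph \<Rightarrow> 'a \<Rightarrow> 'a graph" where
  "component G v = Graph (ffilter (connected_to G v) (verts G))
     (ffilter (\<lambda>e. \<exists>w. w |\<in>| e \<and> connected_to G v w) (edges G))"

text \<open>In the Mutual Failures Variant, a position in which one player has no safe deletion is a
  dead end for both players. A disconnected graph is the disjunctive sum of its components, so
  the condition is applied to each component: for instance, Left may not shorten a path on three
  vertices, even when other components are still in play.\<close>

definition live :: "'a graph \<Rightarrow> bool" where
  "live C \<longleftrightarrow> (\<exists>v. left_safe C v) \<and> (\<exists>e. right_safe C e)"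

definition left_available :: "'a graph \<Rightarrow> 'a \<Rightarrow> bool" where
  "left_available G v \<longleftrightarrow> left_safe G v \<and> live (component G v)"

definition right_available :: "'a graph \<Rightarrow> 'a fset \<Rightarrow> bool" where
  "right_available G e \<longleftrightarrow> right_safe G e \<and> (\<exists>u. u |\<in>| e \<and> live (component G u))"

lemma connected_to_refl [simp]: "connected_to G v v"
  by (simp add: connected_to_def)

lemma connected_to_sym: "connected_to G v w \<Longrightarrow> connected_to G w v"
proof -
  have "sym {(x, y). {|x, y|} |\<in>| edges G}"
    by (auto simp: sym_def finsert_commute)
  then show "connected_to G v w \<Longrightarrow> connected_to G w v"
    unfolding connected_to_def by (metis sym_rtrancl symD)
qed

lemma connected_to_trans: "connected_to G u v \<Longrightarrow> connected_to G v w \<Longrightarrow> connected_to G u w"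
  unfolding connected_to_def by (rule rtrancl_trans)

lemma simple_graph_edge:
  assumes "simple_graph G" "e |\<in>| edges G" "x |\<in>| e" "y |\<in>| e"
  shows "connected_to G x y" "x |\<in>| verts G"
proof -
  have "card (fset e) = 2"
    using assms by (auto simp: simple_graph_def fcard.rep_eq)
  then obtain a b where "fset e = {a, b}"
    by (auto simp: card_2_iff)
  then have "e = {|x, y|} \<or> x = y"
    using assms(3,4) by (auto simp: fset_inject[symmetric])
  then show "connected_to G x y"
    using assms(2) by (auto simp: connected_to_def)
  show "x |\<in>| verts G"
    using assms by (auto simp: simple_graph_def)
qed

lemma component_eq: "connected_to G v w \<Longrightarrow> component G v = component G w"
proof -
  assume "connected_to G v w"
  then have "connected_to G v = connected_to G w"
    by (auto simp: fun_eq_iff dest: connected_to_sym connected_to_trans)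
  then show ?thesis
    by (simp add: component_def)
qed

lemma right_safe_component:
  assumes G: "simple_graph G" and e: "right_safe (component G v) e"
  shows "right_safe G e"
proof -
  from e obtain w where w: "e |\<in>| edges G" "w |\<in>| e" "connected_to G v w"
    by (auto simp: right_safe_def component_def)
  have False if x: "isolated (delete_edge G e) x" "\<not> isolated G x" for x
  proof -
    have "x |\<in>| e"
      using x by (auto simp: isolated_def delete_edge_def)
    with w G have "connected_to G v x"
      by (meson simple_graph_edge connected_to_trans)
    then have "isolated (delete_edge (component G v) e) x" "\<not> isolated (component G v) x"
      using x w \<open>x |\<in>| e\<close> by (auto simp: isolated_def delete_edge_def component_def)
    with e show False
      by (auto simp: right_safe_def creates_isolated_def)
  qed
  with w show ?thesis
    by (auto simp: right_safe_def creates_isolated_def)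
qed

lemma left_safe_component:
  assumes G: "simple_graph G" and w: "left_safe (component G v) w"
  shows "left_safe G w"
proof -
  have w': "w |\<in>| verts G" "connected_to G v w"
    using w by (auto simp: left_safe_def component_def)
  have False if x: "isolated (delete_vertex G w) x" "\<not> isolated G x" for x
  proof -
    obtain f where f: "f |\<in>| edges G" "x |\<in>| f" "w |\<in>| f"
      using x by (auto simp: isolated_def delete_vertex_def)
    with w' G have "connected_to G v x"
      by (meson simple_graph_edge connected_to_trans)
    then have "isolated (delete_vertex (component G v) w) x" "\<not> isolated (component G v) x"
      using x w' f by (auto simp: isolated_def delete_vertex_def component_def)
    with w show False
      by (auto simp: left_safe_def creates_isolated_def)
  qed
  with w' show ?thesis
    by (auto simp: left_safe_def creates_isolated_def)
qed

text \<open>The defining condition of the variant holds in every position.\<close>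

lemma mutual_failures:
  assumes G: "simple_graph G"
  shows "(\<exists>v. left_available G v) \<longleftrightarrow> (\<exists>e. right_available G e)"
proof
  assume "\<exists>v. left_available G v"
  then obtain v e where v: "live (component G v)" "right_safe (component G v) e"
    by (auto simp: left_available_def live_def)
  from v(2) obtain w where "w |\<in>| e" "connected_to G v w"
    by (auto simp: right_safe_def component_def)
  with v show "\<exists>e. right_available G e"
    using right_safe_component[OF G v(2)] unfolding right_available_def by (metis component_eq)
next
  assume "\<exists>e. right_available G e"
  then obtain u v where u: "live (component G u)" "left_safe (component G u) v"
    by (auto simp: right_available_def live_def)
  from u(2) have "connected_to G u v"
    by (auto simp: left_safe_def component_def)
  with u show "\<exists>v. left_available G v"
    using left_safe_component[OF G u(2)] unfolding left_available_def by (metis component_eq)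
qed

function position :: "'a graph \<Rightarrow> game" where
  "position G = Game
     ((\<lambda>v. position (delete_vertex G v)) |`| ffilter (left_available G) (verts G))
     ((\<lambda>e. position (delete_edge G e)) |`| ffilter (right_available G) (edges G))"
  by pat_completeness auto
termination
proof (relation "measure (\<lambda>G. fcard (verts G) + fcard (edges G))")
  fix G :: "'a graph" and v
  assume "v |\<in>| ffilter (left_available G) (verts G)"
  then have "fcard (verts (delete_vertex G v)) < fcard (verts G)"
    by (metis delete_vertex_def fcard_fminus1_less ffmember_filter graph.sel(1))
  moreover have "fcard (edges (delete_vertex G v)) \<le> fcard (edges G)"
    by (auto simp: delete_vertex_def intro!: fcard_mono)
  ultimately show "(delete_vertex G v, G) \<in> measure (\<lambda>G. fcard (verts G) + fcard (edges G))"
    by simp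
next
  fix G :: "'a graph" and e
  assume "e |\<in>| ffilter (right_available G) (edges G)"
  then have "fcard (edges (delete_edge G e)) < fcard (edges G)"
    by (metis delete_edge_def fcard_fminus1_less ffmember_filter graph.sel(2))
  then show "(delete_edge G e, G) \<in> measure (\<lambda>G. fcard (verts G) + fcard (edges G))"
    by (simp add: delete_edge_def)
qed simp

declare position.simps [simp del]

definition graph_union :: "'a graph \<Rightarrow> 'a graph \<Rightarrow> 'a graph" where
  "graph_union G H = Graph (verts G |\<union>| verts H) (edges G |\<union>| edges H)"

lemma graph_union_commute: "graph_union G H = graph_union H G"
  by (auto simp: graph_union_def)

lemma simple_graph_delete:
  assumes "simple_graph G"
  shows "simple_graph (delete_vertex G v)" "simple_graph (delete_edge G e)"
  using assms by (auto simp: simple_graph_def delete_vertex_def delete_edge_def)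

lemma isolated_graph_union:
  assumes G: "simple_graph G" and H: "simple_graph H" and "verts G |\<inter>| verts H = {||}"
  shows "isolated (graph_union G H) v \<longleftrightarrow> isolated G v \<or> isolated H v"
proof -
  have "v |\<notin>| verts G \<or> v |\<notin>| verts H"
    using assms(3) by auto
  moreover have "v |\<in>| verts G" if "e |\<in>| edges G" "v |\<in>| e" for e
    using simple_graph_edge(2)[OF G that that(2)] .
  moreover have "v |\<in>| verts H" if "e |\<in>| edges H" "v |\<in>| e" for e
    using simple_graph_edge(2)[OF H that that(2)] .
  ultimately show ?thesis
    unfolding isolated_def graph_union_def by auto
qed

context
  fixes G H :: "'a graph"
  assumes G: "simple_graph G" and H: "simple_graph H"
    and disj: "verts G |\<inter>| verts H = {||}"
begin

lemma connected_to_graph_union: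
  assumes "v |\<in>| verts G"
  shows "connected_to (graph_union G H) v w \<longleftrightarrow> connected_to G v w"
    and "connected_to G v w \<Longrightarrow> w |\<in>| verts G"
proof -
  have *: "connected_to G v w \<and> w |\<in>| verts G" if "connected_to (graph_union G H) v w" for w
    using that unfolding connected_to_def
  proof (induction rule: rtrancl_induct)
    case base
    then show ?case using assms by simp
  next
    case (step y z)
    then have "{|y, z|} |\<in>| edges G"
      using H disj by (fastforce simp: graph_union_def simple_graph_def)
    with step G show ?case
      by (fastforce simp: simple_graph_def intro: rtrancl.rtrancl_into_rtrancl)
  qed
  have **: "connected_to (graph_union G H) v w" if "connected_to G v w" for w
    using that unfolding connected_to_def
    by (rule rtrancl_mono[THEN subsetD, rotated]) (auto simp: graph_union_def)
  show "connected_to (graph_union G H) v w \<longleftrightarrow> connected_to G v w"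
    using * ** by blast
  show "connected_to G v w \<Longrightarrow> w |\<in>| verts G"
    using * ** by blast
qed

lemma component_graph_union:
  assumes "v |\<in>| verts G"
  shows "component (graph_union G H) v = component G v"
proof -
  have "connected_to (graph_union G H) v = connected_to G v"
    using connected_to_graph_union(1)[OF assms] by blast
  moreover have "e |\<notin>| edges H" if "w |\<in>| e" "connected_to G v w" for e w
    using that connected_to_graph_union(2)[OF assms] H disj by (fastforce simp: simple_graph_def)
  moreover have "w |\<notin>| verts H" if "connected_to G v w" for w
    using that connected_to_graph_union(2)[OF assms] disj by fastforce
  ultimately show ?thesis
    by (auto simp: component_def graph_union_def)
qed

lemma delete_vertex_graph_union:
  assumes "v |\<in>| verts G"
  shows "delete_vertex (graph_union G H) v = graph_union (delete_vertex G v) H"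
  using assms H disj by (fastforce simp: delete_vertex_def graph_union_def simple_graph_def)

lemma edge_not_both: "e |\<in>| edges G \<Longrightarrow> e |\<notin>| edges H"
proof
  assume e: "e |\<in>| edges G" "e |\<in>| edges H"
  then have "e |\<subseteq>| {||}"
    using G H unfolding disj[symmetric] by (simp add: simple_graph_def)
  then have "fcard e = 0"
    by simp
  with e G show False
    by (simp add: simple_graph_def)
qed

lemma delete_edge_graph_union:
  assumes "e |\<in>| edges G"
  shows "delete_edge (graph_union G H) e = graph_union (delete_edge G e) H"
  using edge_not_both[OF assms] by (auto simp: delete_edge_def graph_union_def)

lemma right_available_graph_union:
  assumes "e |\<in>| edges G"
  shows "right_available (graph_union G H) e \<longleftrightarrow> right_available G e"
proof -
  have "e |\<subseteq>| verts G"
    using assms G by (simp add: simple_graph_def)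
  then have "component (graph_union G H) u = component G u" if "u |\<in>| e" for u
    using that by (auto intro!: component_graph_union)
  moreover have "right_safe (graph_union G H) e \<longleftrightarrow> right_safe G e"
  proof -
    have "isolated (graph_union (delete_edge G e) H) v \<longleftrightarrow> isolated (delete_edge G e) v \<or> isolated H v"
      for v
      using simple_graph_delete(2)[OF G] H disj
      by (intro isolated_graph_union) (auto simp: delete_edge_def)
    moreover have "\<not> isolated H v" if "isolated (delete_edge G e) v" for v
      using that disj by (fastforce simp: isolated_def delete_edge_def)
    ultimately show ?thesis
      using assms unfolding right_safe_def creates_isolated_def
        delete_edge_graph_union[OF assms] isolated_graph_union[OF G H disj]
      by (auto simp: graph_union_def)
  qed
  ultimately show ?thesis
    by (auto simp: right_available_def)
qed

lemma left_available_graph_union: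
  assumes "v |\<in>| verts G"
  shows "left_available (graph_union G H) v \<longleftrightarrow> left_available G v"
proof -
  have "left_safe (graph_union G H) v \<longleftrightarrow> left_safe G v"
  proof -
    have "isolated (graph_union (delete_vertex G v) H) w \<longleftrightarrow>
        isolated (delete_vertex G v) w \<or> isolated H w" for w
      using simple_graph_delete(1)[OF G] H disj
      by (intro isolated_graph_union) (auto simp: delete_vertex_def)
    moreover have "\<not> isolated H w" if "isolated (delete_vertex G v) w" for w
      using that disj by (fastforce simp: isolated_def delete_vertex_def)
    ultimately show ?thesis
      using assms unfolding left_safe_def creates_isolated_def
        delete_vertex_graph_union[OF assms] isolated_graph_union[OF G H disj]
      by (auto simp: graph_union_def)
  qed
  then show ?thesis
    by (simp add: left_available_def component_graph_union[OF assms])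
qed

end

text \<open>The vertex-disjoint union of two positions is their disjunctive sum.\<close>

lemma position_graph_union:
  assumes "simple_graph G" "simple_graph H" "verts G |\<inter>| verts H = {||}"
  shows "position (graph_union G H) = position G + position H"
  using assms
proof (induction "fcard (verts G) + fcard (edges G) + fcard (verts H) + fcard (edges H)"
    arbitrary: G H rule: less_induct)
  case less
  note G = less.prems(1) and H = less.prems(2) and disj = less.prems(3)
  have disj': "verts H |\<inter>| verts G = {||}"
    using disj by (simp add: inf_commute)
  note GH = G H disj and HG = H G disj'
  have V: "fcard (verts (delete_vertex K v)) < fcard (verts K)"
      "fcard (edges (delete_vertex K v)) \<le> fcard (edges K)"
    if "v |\<in>| verts K" for K :: "'a graph" and v
    using fcard_fminus1_less[OF that]
    by (simp_all only: delete_vertex_def graph.sel) (auto intro!: fcard_mono)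
  have E: "verts (delete_edge K e) = verts K"
      "fcard (edges (delete_edge K e)) < fcard (edges K)"
    if "e |\<in>| edges K" for K :: "'a graph" and e
    using fcard_fminus1_less[OF that] by (simp_all only: delete_edge_def graph.sel)
  have sub: "verts (delete_vertex K v) |\<subseteq>| verts K" for K :: "'a graph" and v
    by (auto simp: delete_vertex_def)
  have disj_sub: "A' |\<inter>| B = {||}" if "A' |\<subseteq>| A" "A |\<inter>| B = {||}" for A A' B :: "'a fset"
    using that by auto
  have LG: "position (delete_vertex (graph_union G H) v) = position (delete_vertex G v) + position H"
    if v: "v |\<in>| verts G" for v
    unfolding delete_vertex_graph_union[OF GH v]
    by (rule less.hyps) (use V[OF v] disj_sub[OF sub[of G v] disj] G H simple_graph_delete(1)[OF G] in simp_all)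
  have LH: "position (delete_vertex (graph_union G H) v) = position G + position (delete_vertex H v)"
    if v: "v |\<in>| verts H" for v
    unfolding graph_union_commute[of G H] delete_vertex_graph_union[OF HG v]
    unfolding graph_union_commute[of _ G]
    by (rule less.hyps) (use V[OF v] disj_sub[OF sub[of H v] disj'] G H simple_graph_delete(1)[OF H] in \<open>simp_all add: inf_commute\<close>)
  have RG: "position (delete_edge (graph_union G H) e) = position (delete_edge G e) + position H"
    if e: "e |\<in>| edges G" for e
    unfolding delete_edge_graph_union[OF GH e]
    by (rule less.hyps) (use E[OF e] GH simple_graph_delete(2)[OF G] in simp_all)
  have RH: "position (delete_edge (graph_union G H) e) = position G + position (delete_edge H e)"
    if e: "e |\<in>| edges H" for e
    unfolding graph_union_commute[of G H] delete_edge_graph_union[OF HG e]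
    unfolding graph_union_commute[of _ G]
    by (rule less.hyps) (use E[OF e] GH simple_graph_delete(2)[OF H] in simp_all)
  have aL: "ffilter (left_available (graph_union G H)) (verts (graph_union G H)) =
      ffilter (left_available G) (verts G) |\<union>| ffilter (left_available H) (verts H)"
    using left_available_graph_union[OF GH] left_available_graph_union[OF HG]
    by (auto simp: graph_union_commute[of H G]) (auto simp: graph_union_def)
  have aR: "ffilter (right_available (graph_union G H)) (edges (graph_union G H)) =
      ffilter (right_available G) (edges G) |\<union>| ffilter (right_available H) (edges H)"
    using right_available_graph_union[OF GH] right_available_graph_union[OF HG]
    by (auto simp: graph_union_commute[of H G]) (auto simp: graph_union_def)
  show ?case
    unfolding plus_game.simps[of "position G" "position H"]
    unfolding position.simps[of "graph_union G H"] aL aR fimage_funion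
    unfolding position.simps[of G, THEN arg_cong, of left_opts]
      position.simps[of H, THEN arg_cong, of left_opts]
      position.simps[of G, THEN arg_cong, of right_opts]
      position.simps[of H, THEN arg_cong, of right_opts] game.sel fset.map_comp o_def
    by (intro arg_cong2[where f = Game] arg_cong2[where f = funion] fimage_cong refl)
      (auto simp: LG LH RG RH)
qed

definition path_graph :: "nat \<Rightarrow> nat graph" where
  "path_graph n = Graph (fset_of_list [0..<n]) ((\<lambda>i. {|i, Suc i|}) |`| fset_of_list [0..<n - 1])"

lemma simple_graph_path_graph: "simple_graph (path_graph n)"
  by (auto simp: simple_graph_def path_graph_def fset_of_list_elem fcard.rep_eq)

end

theory Submission
  imports Defs
begin

text \<open>Write \<open>P\<^sub>n\<close> for the path. Atomic weights are computed by the recursion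
  \<open>AW G = 1 + min AW(G\<^sup>R)\<close>, valid when Left's options are not too good and Left wins
  moving first on \<open>G + nim j\<close> for every \<open>j\<close>. Since Right splits \<open>P\<^sub>n\<close> into
  \<open>P\<^sub>a + P\<^sub>b\<close> with \<open>a, b \<ge> 2\<close>, and \<open>P\<^sub>1, \<dots>, P\<^sub>4\<close> have atomic weight 0, this gives
  \<open>AW(P\<^sub>n) = \<lceil>n / 4\<rceil> - 1\<close>: every split adds one and a piece is worth nothing once it has at
  most four vertices.\<close>

section \<open>The group of game values\<close>

text \<open>Far star equivalence quantifies over every test position \<open>X\<close>, so weights
  are obtained from a sandwich criterion, \<open>far_star_equivalentI\<close>, which itself needs an
  induction over game trees. The obstacle throughout is that the far star is a heap in play: a
  player may reduce it to a small heap, about which eventual statements say nothing. Two facts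
  bridge the gap: distinct heaps are incomparable, and one \<open>up\<close> outweighs every heap
  except \<open>star\<close>. They carry comparisons from far heaps back to arbitrary ones
  (\<open>one_ahead\<close>, \<open>two_behind\<close>).

  The 4 in the formula stems from P_4 = \<open>star\<close>, the longest path of weight 0. In P_5
  every cut leaves value 0, while Left can reach both 0 and \<open>star\<close>. Cutting a path into
  a and b vertices lowers (n - 1) div 4 by at most one, and cutting off P_4 lowers it by exactly
  one.

  That P_n exceeds the far star is no separate task: to win moving first beside a heap of size at
  least 2, Left shortens the path and relies on winning as second player on P_(n-1), so both claims
  run in one induction.\<close>

lemma game_eqI: "left_opts G = left_opts H \<Longrightarrow> right_opts G = right_opts H \<Longrightarrow> G = H"
  by (cases G; cases H) simp

lemma left_opts_plus: "left_opts (G + H) =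
    (\<lambda>g. g + H) |`| left_opts G |\<union>| (\<lambda>h. G + h) |`| left_opts H"
  and right_opts_plus: "right_opts (G + H) =
    (\<lambda>g. g + H) |`| right_opts G |\<union>| (\<lambda>h. G + h) |`| right_opts H"
  by (subst plus_game.simps, simp)+

lemma left_opts_zero [simp]: "left_opts 0 = {||}"
  and right_opts_zero [simp]: "right_opts 0 = {||}"
  by (simp_all add: zero_game_def)

instance game :: comm_monoid_add
proof
  fix A B C :: game
  show "A + B = B + A"
  proof (induction "size A + size B" arbitrary: A B rule: less_induct)
    case less
    then show ?case
      by (intro game_eqI; unfold left_opts_plus right_opts_plus; subst sup_commute)
        (intro arg_cong2[where f = funion] fimage_cong refl less.hyps;
          simp add: size_left_opts size_right_opts)+
  qed
  show "A + B + C = A + (B + C)"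
  proof (induction "size A + size B + size C" arbitrary: A B C rule: less_induct)
    case less
    then show ?case
      by (intro game_eqI; unfold left_opts_plus right_opts_plus fimage_funion fset.map_comp
          sup_assoc o_def)
        (intro arg_cong2[where f = funion] fimage_cong refl less.hyps;
          simp add: size_left_opts size_right_opts)+
  qed
  show "0 + A = A"
  proof (induction "size A" arbitrary: A rule: less_induct)
    case less
    have "(\<lambda>h. 0 + h) |`| left_opts A = (\<lambda>h. h) |`| left_opts A"
      "(\<lambda>h. 0 + h) |`| right_opts A = (\<lambda>h. h) |`| right_opts A"
      by (intro fimage_cong refl less.hyps; simp add: size_left_opts size_right_opts)+
    then show ?case
      by (intro game_eqI) (simp_all add: left_opts_plus right_opts_plus)
  qed
qed

lemma left_opts_uminus [simp]: "left_opts (- G) = uminus |`| right_opts G"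
  and right_opts_uminus [simp]: "right_opts (- G) = uminus |`| left_opts G"
  by (cases G; simp)+

lemma uminus_zero_game [simp]: "- 0 = (0 :: game)"
  by (intro game_eqI) simp_all

lemma uminus_uminus_game [simp]: "- (- G) = (G :: game)"
proof (induction "size G" arbitrary: G rule: less_induct)
  case less
  have "(\<lambda>g. - (- g)) |`| left_opts G = (\<lambda>g. g) |`| left_opts G"
    "(\<lambda>g. - (- g)) |`| right_opts G = (\<lambda>g. g) |`| right_opts G"
    by (intro fimage_cong refl less.hyps; simp add: size_left_opts size_right_opts)+
  then show ?case
    by (intro game_eqI) (simp_all add: fset.map_comp o_def)
qed

lemma uminus_plus_game: "- (G + H) = - G + - (H :: game)"
proof (induction "size G + size H" arbitrary: G H rule: less_induct)
  case less
  then show ?case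
    by (intro game_eqI; unfold left_opts_plus right_opts_plus left_opts_uminus right_opts_uminus
        fimage_funion fset.map_comp o_def)
      (intro arg_cong2[where f = funion] fimage_cong refl less.hyps;
        simp add: size_left_opts size_right_opts)+
qed

section \<open>Outcomes of sums and negatives\<close>

lemma wins_first_Left: "wins_first Left G \<longleftrightarrow> (\<exists>g. g |\<in>| left_opts G \<and> \<not> wins_first Right g)"
  and wins_first_Right: "wins_first Right G \<longleftrightarrow> (\<exists>g. g |\<in>| right_opts G \<and> \<not> wins_first Left g)"
  by (subst wins_first.simps; force)+

lemma wins_first_uminus:
  "(wins_first Left (- G) \<longleftrightarrow> wins_first Right G) \<and> (wins_first Right (- G) \<longleftrightarrow> wins_first Left G)"
proof (induction "size G" arbitrary: G rule: less_induct)
  case less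
  then show ?case
    unfolding wins_first_Left[of "- G"] wins_first_Right[of "- G"]
      wins_first_Left[of G] wins_first_Right[of G]
    by (auto simp: size_left_opts size_right_opts)
qed

text \<open>Left answers every move of Right in the summand where it was made; if she starts, she
  opens with her winning move in \<open>H\<close>. Each claim feeds the induction step of the
  other.\<close>

lemma wins_first_plus:
  "(\<not> wins_first Right G \<longrightarrow> \<not> wins_first Right H \<longrightarrow> \<not> wins_first Right (G + H)) \<and>
   (\<not> wins_first Right G \<longrightarrow> wins_first Left H \<longrightarrow> wins_first Left (G + H))"
proof (induction "size G + size H" arbitrary: G H rule: less_induct)
  case less
  have "\<not> wins_first Right (G + H)" if GH: "\<not> wins_first Right G" "\<not> wins_first Right H"
  proof -
    have "wins_first Left (g + H)" if "g |\<in>| right_opts G" for g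
      using less.hyps[of H g] GH that size_right_opts[OF that]
      by (auto simp: wins_first_Right[of G] add.commute)
    moreover have "wins_first Left (G + h)" if "h |\<in>| right_opts H" for h
      using less.hyps[of G h] GH that size_right_opts[OF that]
      by (auto simp: wins_first_Right[of H])
    ultimately show ?thesis
      by (auto simp: wins_first_Right[of "G + H"] right_opts_plus)
  qed
  moreover have "wins_first Left (G + H)" if GH: "\<not> wins_first Right G" "wins_first Left H"
  proof -
    obtain h where h: "h |\<in>| left_opts H" "\<not> wins_first Right h"
      using GH by (auto simp: wins_first_Left[of H])
    then have "\<not> wins_first Right (G + h)"
      using less.hyps[of G h] GH size_left_opts[OF h(1)] by auto
    with h show ?thesis
      by (auto simp: wins_first_Left[of "G + H"] left_opts_plus)
  qed
  ultimately show ?case by blast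
qed

text \<open>The second player copies each move in the other summand.\<close>

lemma wins_first_plus_uminus: "\<not> wins_first p (G + - G)"
proof -
  have *: "\<not> wins_first Right (G + - G)" for G
  proof (induction "size G" arbitrary: G rule: less_induct)
    case less
    have "wins_first Left (g + - G)" if "g |\<in>| right_opts G" for g
      using less.hyps[of g] that size_right_opts[OF that]
      unfolding wins_first_Left[of "g + - G"] left_opts_plus by auto
    moreover have "wins_first Left (G + - g)" if "g |\<in>| left_opts G" for g
      using less.hyps[of g] that size_left_opts[OF that]
      unfolding wins_first_Left[of "G + - g"] left_opts_plus by auto
    ultimately show ?case
      by (auto simp: wins_first_Right[of "G + - G"] right_opts_plus)
  qed
  moreover have "\<not> wins_first Left (G + - G)"
    using *[of "- G"] wins_first_uminus[of "G + - G"]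
    by (simp add: uminus_plus_game)
  ultimately show ?thesis
    by (cases p) auto
qed

text \<open>\<open>K\<close> is a second player win, so \<open>wins_first_plus\<close> carries
  Left's wins from \<open>G\<close> to \<open>G + K\<close>; applied to the negatives it carries
  Right's.\<close>

lemma wins_first_plus_zero_value:
  assumes "\<And>p. \<not> wins_first p K"
  shows "wins_first p (G + K) = wins_first p G"
proof -
  have *: "wins_first Left (G + K) = wins_first Left G \<and> wins_first Right (G + K) = wins_first Right G"
    using wins_first_plus[of G K] wins_first_plus[of K G] wins_first_plus[of "- G" "- K"]
      wins_first_plus[of "- K" "- G"] wins_first_uminus[of "G + K"]
      wins_first_uminus[of G] wins_first_uminus[of K] assms
    unfolding add.commute[of K G] add.commute[of "- K" "- G"] uminus_plus_game by metis
  then show ?thesis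
    by (cases p) auto
qed

lemma le_game_cancel: "A + C \<le> B + C \<longleftrightarrow> A \<le> (B :: game)"
proof -
  have "(B + C) - (A + C) = (B - A) + (C + - C)"
    by (simp add: minus_game_def uminus_plus_game ac_simps)
  then show ?thesis
    by (simp add: less_eq_game_def wins_first_plus_zero_value wins_first_plus_uminus)
qed

instance game :: preorder
proof
  fix A B C :: game
  show "A < B \<longleftrightarrow> A \<le> B \<and> \<not> B \<le> A"
    by (simp add: less_game_def)
  show "A \<le> A"
    by (simp add: less_eq_game_def minus_game_def wins_first_plus_uminus)
  assume "A \<le> B" "B \<le> C"
  then have "\<not> wins_first Right ((B - A) + (C - B))"
    using wins_first_plus by (auto simp: less_eq_game_def)
  also have "(B - A) + (C - B) = (C - A) + (B + - B)"
    by (simp add: minus_game_def ac_simps)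
  finally show "A \<le> C"
    by (simp add: less_eq_game_def wins_first_plus_zero_value wins_first_plus_uminus)
qed

lemma le_uminus_game: "- A \<le> - B \<longleftrightarrow> B \<le> (A :: game)"
  by (simp add: less_eq_game_def minus_game_def add.commute)

lemma add_mono_game: "A \<le> B \<Longrightarrow> C \<le> D \<Longrightarrow> A + C \<le> B + (D :: game)"
  by (metis le_game_cancel add.commute order_trans)

\<comment> \<open>Distinct trees may be equivalent, so on \<open>game\<close> the order is not
  antisymmetric and \<open>G + - G\<close> is not the tree \<open>0\<close>. Its quotient is an
  ordered abelian group, where cancellation and the algebraic simp rules apply.\<close>
quotient_type game_value = game / "\<lambda>G H :: game. G \<le> H \<and> H \<le> G"
  by (rule equivpI) (auto intro!: reflpI sympI transpI intro: order_trans)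

instantiation game_value :: ordered_ab_group_add
begin

lift_definition zero_game_value :: game_value is 0 .
lift_definition plus_game_value :: "game_value \<Rightarrow> game_value \<Rightarrow> game_value" is plus
  by (auto intro: add_mono_game)
lift_definition uminus_game_value :: "game_value \<Rightarrow> game_value" is uminus
  by (simp add: le_uminus_game)
lift_definition minus_game_value :: "game_value \<Rightarrow> game_value \<Rightarrow> game_value" is minus
  by (auto simp: minus_game_def le_uminus_game intro!: add_mono_game)
lift_definition less_eq_game_value :: "game_value \<Rightarrow> game_value \<Rightarrow> bool" is less_eq
  by (meson order_trans)
lift_definition less_game_value :: "game_value \<Rightarrow> game_value \<Rightarrow> bool" is less
  by (meson less_le_not_le order_trans)

instance
proof
  fix a b c :: game_value
  show "a + b + c = a + (b + c)"
    by transfer (simp add: add.assoc)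
  show "a + b = b + a"
    by transfer (simp add: add.commute)
  show "0 + a = a"
    by transfer simp
  show "- a + a = 0"
    by transfer
      (use wins_first_plus_uminus wins_first_plus_uminus[of _ "- _"] in
        \<open>auto simp: less_eq_game_def minus_game_def uminus_plus_game add.commute\<close>)
  show "a - b = a + - b"
    by transfer (simp add: minus_game_def)
  show "a < b \<longleftrightarrow> a \<le> b \<and> \<not> b \<le> a"
    by transfer (rule less_le_not_le)
  show "a \<le> a"
    by transfer simp
  show "a \<le> b \<Longrightarrow> b \<le> c \<Longrightarrow> a \<le> c"
    by transfer (rule order_trans)
  show "a \<le> b \<Longrightarrow> b \<le> a \<Longrightarrow> a = b"
    by transfer simp
  show "a \<le> b \<Longrightarrow> c + a \<le> c + b"
    by transfer (simp add: add_mono_game)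
qed

end

lift_definition val :: "game \<Rightarrow> game_value" is "\<lambda>G. G" .

lemma val_plus [simp]: "val (G + H) = val G + val H"
  and val_zero [simp]: "val 0 = 0"
  and val_uminus [simp]: "val (- G) = - val G"
  and val_le: "val G \<le> val H \<longleftrightarrow> G \<le> H"
  by (transfer, simp)+

lemma wins_first_Left_val: "wins_first Left G \<longleftrightarrow> \<not> val G \<le> 0"
  and wins_first_Right_val: "wins_first Right G \<longleftrightarrow> \<not> 0 \<le> val G"
  using wins_first_uminus[of G] unfolding val_zero[symmetric] val_le
  by (simp_all add: less_eq_game_def minus_game_def)

lemma val_nonneg_iff: "0 \<le> val G \<longleftrightarrow> (\<forall>g. g |\<in>| right_opts G \<longrightarrow> \<not> val g \<le> 0)"
  and val_nonpos_iff: "val G \<le> 0 \<longleftrightarrow> (\<forall>g. g |\<in>| left_opts G \<longrightarrow> \<not> 0 \<le> val g)"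
  using wins_first_Right[of G] wins_first_Left[of G]
  by (auto simp: wins_first_Left_val wins_first_Right_val)

lemma same_outcome_val:
  "same_outcome G H \<longleftrightarrow> (val G \<le> 0 \<longleftrightarrow> val H \<le> 0) \<and> (0 \<le> val G \<longleftrightarrow> 0 \<le> val H)"
proof -
  have "(\<forall>p. P p) \<longleftrightarrow> P Left \<and> P Right" for P
    by (metis player.exhaust)
  then show ?thesis
    by (simp add: same_outcome_def wins_first_Left_val wins_first_Right_val)
qed

section \<open>Nim heaps and multiples of up\<close>

lemma fuzzy_leftI: "g |\<in>| left_opts G \<Longrightarrow> 0 \<le> val g \<Longrightarrow> \<not> val G \<le> 0"
  and fuzzy_rightI: "g |\<in>| right_opts G \<Longrightarrow> val g \<le> 0 \<Longrightarrow> \<not> 0 \<le> val G"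
  using val_nonpos_iff[of G] val_nonneg_iff[of G] by blast+

text \<open>The rest of the sum enters only through its value \<open>v\<close>, with
  \<open>H\<close> as a witness that some tree has that value. So \<open>v\<close> may be written in
  whatever algebraic form is at hand.\<close>

lemma fuzzy_left_plusI: "g |\<in>| left_opts G \<Longrightarrow> 0 \<le> val g + v \<Longrightarrow> v = val H \<Longrightarrow> \<not> val G + v \<le> 0"
  and fuzzy_right_plusI: "g |\<in>| right_opts G \<Longrightarrow> val g + v \<le> 0 \<Longrightarrow> v = val H \<Longrightarrow> \<not> 0 \<le> val G + v"
  using fuzzy_leftI[of "g + H" "G + H"] fuzzy_rightI[of "g + H" "G + H"]
  by (auto simp: left_opts_plus right_opts_plus)

abbreviation nv :: "nat \<Rightarrow> game_value" where
  "nv m \<equiv> val (nim m)"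

lemma nim_opts [simp]:
  "left_opts (nim m) = nim |`| fset_of_list [0..<m]"
  "right_opts (nim m) = nim |`| fset_of_list [0..<m]"
  by (subst nim.simps, simp)+

lemma nim_optI: "j < m \<Longrightarrow> nim j |\<in>| left_opts (nim m)" "j < m \<Longrightarrow> nim j |\<in>| right_opts (nim m)"
  by (auto simp: fset_of_list_elem)

lemma nim_0 [simp]: "nim 0 = 0"
  by (intro game_eqI) simp_all

lemma uminus_nim [simp]: "- nim m = nim m"
proof (induction m rule: less_induct)
  case (less m)
  have "(\<lambda>j. - nim j) |`| fset_of_list [0..<m] = nim |`| fset_of_list [0..<m]"
    by (intro fimage_cong refl) (simp add: fset_of_list_elem less)
  then show ?case
    by (intro game_eqI)
      (simp_all only: left_opts_uminus right_opts_uminus nim_opts fset.map_comp o_def)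
qed

lemma star_eq_nim: "star = nim 1"
  by (intro game_eqI) (simp_all add: star_def)

lemma uminus_nv [simp]: "- nv m = nv m"
  by (metis val_uminus uminus_nim)

lemma nv_double [simp]: "nv m + nv m = 0" "nv m + (nv m + x) = x"
  by (metis uminus_nv ab_group_add_class.ab_left_minus add.assoc add_0)+

lemma diff_nv [simp]: "x - nv m = x + nv m"
  by (simp add: diff_conv_add_uminus del: add_uminus_conv_diff)

lemma nv_sum_fuzzy:
  assumes "a \<noteq> b"
  shows "\<not> nv a + nv b \<le> 0" "\<not> 0 \<le> nv a + nv b"
proof -
  have *: "\<not> nv a + nv b \<le> 0 \<and> \<not> 0 \<le> nv a + nv b" if "a < b" for a b
    using fuzzy_left_plusI[OF nim_optI(1)[OF that], of "nv a" "nim a"]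
      fuzzy_right_plusI[OF nim_optI(2)[OF that], of "nv a" "nim a"]
    by (simp add: add.commute)
  show "\<not> nv a + nv b \<le> 0" "\<not> 0 \<le> nv a + nv b"
    using *[of a b] *[of b a] assms by (metis add.commute linorder_neqE_nat)+
qed

lemma nv_inj: "nv a = nv b \<longleftrightarrow> a = b"
  using nv_sum_fuzzy(1)[of a b] by (cases "a = b") auto

lemma nv_fuzzy: "m \<noteq> 0 \<Longrightarrow> \<not> nv m \<le> 0 \<and> \<not> 0 \<le> nv m"
  using nv_sum_fuzzy[of m 0] by simp

text \<open>The mex argument: \<open>c\<close> is the least heap size that no option of
  \<open>nim a + nim b\<close> is worth. The options take at most \<open>a + b\<close> values, hence
  the bound, which later replaces estimates on exclusive or.\<close>

lemma nim_sum: "\<exists>c \<le> a + b. nv a + nv b = nv c"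
proof (induction "a + b" arbitrary: a b rule: less_induct)
  case less
  define f where "f j = (SOME c. nv j + nv b = nv c)" for j
  define g where "g j = (SOME c. nv a + nv j = nv c)" for j
  define S where "S = f ` {..<a} \<union> g ` {..<b}"
  have f: "nv (f j) = nv j + nv b" if "j < a" for j
    using less[of j b] that unfolding f_def by (metis (mono_tags, lifting) add_less_mono1 someI)
  have g: "nv (g j) = nv a + nv j" if "j < b" for j
    using less[of a j] that unfolding g_def by (metis (mono_tags, lifting) add_less_cancel_left someI)
  have S: "finite S" "card S \<le> a + b"
    using card_Un_le[of "f ` {..<a}" "g ` {..<b}"] card_image_le[of "{..<a}" f]
      card_image_le[of "{..<b}" g] by (auto simp: S_def)
  have "\<exists>c \<le> a + b. c \<notin> S"
  proof (rule ccontr)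
    assume "\<not> (\<exists>c \<le> a + b. c \<notin> S)"
    then have "{..a + b} \<subseteq> S" by auto
    from card_mono[OF S(1) this] S(2) show False by simp
  qed
  then obtain c0 where c0: "c0 \<le> a + b" "c0 \<notin> S" by blast
  then obtain c where c: "c \<notin> S" "\<And>j. j < c \<Longrightarrow> j \<in> S"
    using exists_least_iff[of "\<lambda>c. c \<notin> S"] by auto
  with c0 have "c \<le> a + b"
    by (meson le_trans not_le_imp_less)
  have "\<not> 0 \<le> nv j + nv b + nv c" if "j < a" for j
    using nv_sum_fuzzy[of "f j" c] c(1) f[OF that] that by (auto simp: S_def)
  moreover have "\<not> 0 \<le> nv a + nv j + nv c" if "j < b" for j
    using nv_sum_fuzzy[of "g j" c] c(1) g[OF that] that by (auto simp: S_def)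
  moreover have "\<not> 0 \<le> nv a + nv b + nv j" if j: "j < c" for j
  proof -
    consider i where "i < a" "j = f i" | i where "i < b" "j = g i"
      using c(2)[OF j] by (auto simp: S_def)
    then show ?thesis
    proof cases
      case 1
      then have "nv a + nv b + nv j = nv a + nv i"
        by (simp only: f) (simp add: ac_simps)
      with nv_sum_fuzzy[of a i] 1(1) show ?thesis by (metis less_irrefl)
    next
      case 2
      then have "nv a + nv b + nv j = nv b + nv i"
        by (simp only: g) (simp add: ac_simps)
      with nv_sum_fuzzy[of b i] 2(1) show ?thesis by (metis less_irrefl)
    qed
  qed
  ultimately have le: "val (nim a + nim b + nim c) \<le> 0"
    unfolding val_nonpos_iff by (auto simp: left_opts_plus fset_of_list_elem)
  \<comment> \<open>A sum of heaps is its own negative, so one inequality already makes it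
    0.\<close>
  moreover have "- val (nim a + nim b + nim c) = val (nim a + nim b + nim c)"
    by (simp add: ac_simps)
  ultimately have "val (nim a + nim b + nim c) = 0"
    by (metis neg_0_le_iff_le order_antisym)
  then have "nv a + nv b = nv c"
    by (metis val_plus nv_double(1) add_right_cancel)
  with \<open>c \<le> a + b\<close> show ?case by blast
qed

section \<open>Up and its integer multiples beside a nim heap\<close>

lemma up_opts [simp]: "left_opts up = {|0|}" "right_opts up = {|nim 1|}"
  by (simp_all add: up_def star_eq_nim)

lemma up_nonneg: "0 \<le> val up"
  using nv_fuzzy[of 1] by (simp add: val_nonneg_iff[of up])

text \<open>Left wins moving first: without a heap she moves \<open>up\<close> to 0, otherwise she
  removes the heap and leaves \<open>up\<close>.\<close>

lemma up_nv_not_nonpos: "\<not> val up + nv m \<le> 0"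
proof -
  consider "m = 0" | "m = 1" | "m > 1" by linarith
  then show ?thesis
  proof cases
    case 1
    then show ?thesis using fuzzy_left_plusI[of 0 up 0 0] by simp
  next
    case 2
    then show ?thesis
      using fuzzy_left_plusI[OF nim_optI(1)[of 0 1], of "val up" up] up_nonneg by (simp add: add.commute)
  next
    case 3
    then show ?thesis
      using fuzzy_left_plusI[OF nim_optI(1)[of 0 m], of "val up" up] up_nonneg by (simp add: add.commute)
  qed
qed

text \<open>Right's only threat is the move from \<open>up\<close> to \<open>star\<close>, which
  leaves 0 exactly beside \<open>nim 1\<close>. The later requirements that a heap differ from 1
  come from here.\<close>

lemma up_nv_nonneg_iff: "0 \<le> val up + nv m \<longleftrightarrow> m \<noteq> 1"
proof
  assume "0 \<le> val up + nv m"
  then show "m \<noteq> 1"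
    using fuzzy_right_plusI[of "nim 1" up "nv 1" "nim 1"] by auto
next
  assume "m \<noteq> 1"
  then have "0 \<le> val (up + nim m)"
    unfolding val_nonneg_iff using nv_sum_fuzzy[of 1 m] up_nv_not_nonpos
    by (auto simp: right_opts_plus fset_of_list_elem)
  then show "0 \<le> val up + nv m" by simp
qed

text \<open>For negative \<open>k\<close> a copy of \<open>- G\<close> cancels against
  \<open>G\<close>, so the identity concerns values and not trees.\<close>

lemma val_int_mult_Suc: "val (int_mult (k + 1) G) = val (int_mult k G) + val G"
proof (cases "0 \<le> k")
  case True
  then show ?thesis
    by (simp add: int_mult_def nat_add_distrib add.commute)
next
  case False
  then have "k = - int (Suc (nat (- k - 1)))"
    by simp
  then obtain n where "k = - int (Suc n)" ..
  then show ?thesis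
    by (cases n) (auto simp: int_mult_def nat_add_distrib)
qed

lemma val_int_mult_add: "val (int_mult (j + k) G) = val (int_mult j G) + val (int_mult k G)"
proof (induction k rule: int_induct[where k = 0])
  case base
  show ?case by (simp add: int_mult_def)
next
  case (step1 i)
  have "val (int_mult (j + (i + 1)) G) = val (int_mult (j + i) G) + val G"
    using val_int_mult_Suc[of "j + i" G] by (simp only: add.assoc)
  then show ?case
    by (simp only: step1 val_int_mult_Suc add.assoc)
next
  case (step2 i)
  have "val (int_mult (j + (i - 1)) G) + val G = val (int_mult (j + (i - 1) + 1) G)"
    by (simp only: val_int_mult_Suc)
  also have "j + (i - 1) + 1 = j + i" by simp
  also note step2(2)
  also have "val (int_mult i G) = val (int_mult (i - 1) G) + val G"
    using val_int_mult_Suc[of "i - 1" G] by simp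
  finally show ?case
    by (simp only: add.assoc[symmetric] add_right_cancel)
qed

abbreviation ups :: "int \<Rightarrow> game_value" where
  "ups k \<equiv> val (int_mult k up)"

lemma ups_0 [simp]: "ups 0 = 0" and ups_1 [simp]: "ups 1 = val up"
  by (simp_all add: int_mult_def)

lemma ups_diff: "ups (j - k) = ups j - ups k"
  using val_int_mult_add[of "j - k" k up] by (simp add: algebra_simps)

lemma ups_uminus: "ups (- k) = - ups k"
  using ups_diff[of 0 k] by simp

lemma ups_mono:
  assumes "j \<le> k"
  shows "ups j \<le> ups k"
  using assms
proof (induction k rule: int_ge_induct)
  case (step i)
  then show ?case
    using add_mono[OF _ up_nonneg, of "ups j" "ups i"] by (simp add: val_int_mult_add)
qed simp

section \<open>Far star\<close>

lemma nonneg_plus_minus_nonpos: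
  "0 \<le> a \<Longrightarrow> 0 \<le> b \<Longrightarrow> c \<le> 0 \<Longrightarrow> 0 \<le> a + b + - (c :: 'a :: ordered_ab_group_add)"
  by (rule add_nonneg_nonneg) simp_all

text \<open>A move is made either in \<open>y\<close> or in the heap. The heap condition ranges over
  an initial segment growing with \<open>m\<close>, so it is monotone in \<open>m\<close>.\<close>

lemma nonneg_plus_nv_iff: "0 \<le> val y + nv m \<longleftrightarrow>
    (\<forall>g\<in>fset (right_opts y). \<not> val g + nv m \<le> 0) \<and> (\<forall>j<m. \<not> val y + nv j \<le> 0)"
  and nonpos_plus_nv_iff: "val y + nv m \<le> 0 \<longleftrightarrow>
    (\<forall>g\<in>fset (left_opts y). \<not> 0 \<le> val g + nv m) \<and> (\<forall>j<m. \<not> 0 \<le> val y + nv j)"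
proof -
  have all: "(\<forall>h\<in>fset ((\<lambda>g. g + nim m) |`| A |\<union>| (\<lambda>h. y + h) |`| nim |`| fset_of_list [0..<m]). P (val h))
      \<longleftrightarrow> (\<forall>g\<in>fset A. P (val g + nv m)) \<and> (\<forall>j<m. P (val y + nv j))" for A P
    by (simp add: ball_Un fset_of_list.rep_eq) (simp add: Ball_def)
  have nonneg: "0 \<le> val h \<longleftrightarrow> (\<forall>g\<in>fset (right_opts h). \<not> val g \<le> 0)"
    and nonpos: "val h \<le> 0 \<longleftrightarrow> (\<forall>g\<in>fset (left_opts h). \<not> 0 \<le> val g)" for h
    using val_nonneg_iff[of h] val_nonpos_iff[of h] by blast+
  show "0 \<le> val y + nv m \<longleftrightarrow>
    (\<forall>g\<in>fset (right_opts y). \<not> val g + nv m \<le> 0) \<and> (\<forall>j<m. \<not> val y + nv j \<le> 0)"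
    unfolding val_plus[of y, symmetric] nonneg[of "y + nim m"] right_opts_plus nim_opts
    by (subst all) simp
  show "val y + nv m \<le> 0 \<longleftrightarrow>
    (\<forall>g\<in>fset (left_opts y). \<not> 0 \<le> val g + nv m) \<and> (\<forall>j<m. \<not> 0 \<le> val y + nv j)"
    unfolding val_plus[of y, symmetric] nonpos[of "y + nim m"] left_opts_plus nim_opts
    by (subst all) simp
qed

lemma uminus_plus_nv: "- v + nv m = - (v + nv m)"
  by simp

lemma uminus_plus_nv_le [simp]:
  "0 \<le> - v + nv m \<longleftrightarrow> v + nv m \<le> 0" "- v + nv m \<le> 0 \<longleftrightarrow> 0 \<le> v + nv m"
  unfolding uminus_plus_nv neg_0_le_iff_le neg_le_0_iff_le by simp_all

text \<open>Finitely many predicates, each eventually true or eventually false, cannot take turns: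
  one fixed witness serves for all large arguments.\<close>

lemma eventually_bex_stable:
  assumes "finite A" "\<And>a. a \<in> A \<Longrightarrow> eventually (P a) F \<or> (\<forall>\<^sub>F m in F. \<not> P a m)"
    and "\<forall>\<^sub>F m in F. \<exists>a\<in>A. P a m" "F \<noteq> bot"
  shows "\<exists>a\<in>A. eventually (P a) F"
proof (rule ccontr)
  assume "\<not> (\<exists>a\<in>A. eventually (P a) F)"
  with assms(2) have "\<forall>\<^sub>F m in F. \<forall>a\<in>A. \<not> P a m"
    using assms(1) by (intro eventually_ball_finite) auto
  with assms(3) have "\<forall>\<^sub>F m in F. False"
    by eventually_elim blast
  with assms(4) show False
    by (simp add: eventually_False)
qed

text \<open>The outcome at \<open>m\<close> combines finitely many options, stable by induction,
  with a condition on all smaller heaps that can only switch from true to false as \<open>m\<close>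
  grows. Hence outcomes beside the far star are well defined.\<close>

lemma far_star_stable:
  "((\<forall>\<^sub>F m in sequentially. 0 \<le> val y + nv m) \<or> (\<forall>\<^sub>F m in sequentially. \<not> 0 \<le> val y + nv m)) \<and>
   ((\<forall>\<^sub>F m in sequentially. val y + nv m \<le> 0) \<or> (\<forall>\<^sub>F m in sequentially. \<not> val y + nv m \<le> 0))"
proof (induction "size y" arbitrary: y rule: less_induct)
  case less
  \<comment> \<open>Covers both inequalities: \<open>Q\<close> is the opposite inequality at an
    option, \<open>R\<close> the opposite inequality at a smaller heap.\<close>
  have step: "eventually P sequentially \<or> (\<forall>\<^sub>F m in sequentially. \<not> P m)"
    if P: "\<And>m. P m \<longleftrightarrow> (\<forall>g\<in>fset A. \<not> Q g m) \<and> (\<forall>j<m. \<not> R j)"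
      and Q: "\<And>g. g |\<in>| A \<Longrightarrow>
        eventually (Q g) sequentially \<or> (\<forall>\<^sub>F m in sequentially. \<not> Q g m)"
    for P R :: "nat \<Rightarrow> bool" and A and Q :: "game \<Rightarrow> nat \<Rightarrow> bool"
  proof -
    consider j where "R j" | g where "g |\<in>| A" "eventually (Q g) sequentially"
      | "\<And>j. \<not> R j" "\<And>g. g |\<in>| A \<Longrightarrow> \<forall>\<^sub>F m in sequentially. \<not> Q g m"
      using Q by blast
    then show ?thesis
    proof cases
      case 1
      have "\<forall>\<^sub>F m in sequentially. \<not> P m"
        using eventually_gt_at_top[of j] by eventually_elim (use 1 in \<open>auto simp: P\<close>)
      then show ?thesis ..
    next
      case 2
      from 2(2) have "\<forall>\<^sub>F m in sequentially. \<not> P m"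
        by eventually_elim (use P 2(1) in blast)
      then show ?thesis ..
    next
      case 3
      then have "\<forall>\<^sub>F m in sequentially. \<forall>g\<in>fset A. \<not> Q g m"
        by (intro eventually_ball_finite) auto
      then have "eventually P sequentially"
        by eventually_elim (use P 3(1) in blast)
      then show ?thesis ..
    qed
  qed
  show ?case
  proof
    show "(\<forall>\<^sub>F m in sequentially. 0 \<le> val y + nv m) \<or> (\<forall>\<^sub>F m in sequentially. \<not> 0 \<le> val y + nv m)"
      by (rule step[OF nonneg_plus_nv_iff]) (rule less[OF size_right_opts, THEN conjunct2])
    show "(\<forall>\<^sub>F m in sequentially. val y + nv m \<le> 0) \<or> (\<forall>\<^sub>F m in sequentially. \<not> val y + nv m \<le> 0)"
      by (rule step[OF nonpos_plus_nv_iff]) (rule less[OF size_left_opts, THEN conjunct1])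
  qed
qed

lemma far_star_pigeonhole:
  assumes "\<forall>\<^sub>F m in sequentially. \<exists>l\<in>fset A. 0 \<le> val (f l) + nv m"
  shows "\<exists>l\<in>fset A. \<forall>\<^sub>F m in sequentially. 0 \<le> val (f l) + nv m"
  using finite_fset _ assms sequentially_bot
  by (rule eventually_bex_stable) (rule far_star_stable[THEN conjunct1])

text \<open>The witness \<open>a\<close> is the nim sum of \<open>j\<close>, \<open>m\<close> and 1.
  Conversely \<open>m\<close> is the nim sum of \<open>a\<close>, 1 and \<open>j\<close>, so
  \<open>m \<le> a + 1 + j\<close> and \<open>a\<close> is large when \<open>m\<close> is. The
  target 1 is the heap that \<open>up\<close> fails to outweigh.\<close>

lemma eventually_nim_balance:
  "\<forall>\<^sub>F m in sequentially. \<exists>a\<ge>N. nv a + nv j + nv m = nv 1"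
proof (rule eventually_sequentiallyI)
  fix m
  assume m: "N + j + 1 \<le> m"
  obtain b where b: "nv j + nv m = nv b"
    using nim_sum by blast
  obtain a where a: "nv b + nv 1 = nv a"
    using nim_sum by blast
  obtain c where c: "nv a + nv 1 = nv c" "c \<le> a + 1"
    using nim_sum by blast
  obtain e where e: "nv c + nv j = nv e" "e \<le> c + j"
    using nim_sum by blast
  have "nv e = nv m"
    unfolding e(1)[symmetric] c(1)[symmetric] a[symmetric] b[symmetric] by (simp add: ac_simps)
  then have "N \<le> a"
    using m c(2) e(2) by (simp add: nv_inj)
  moreover have "nv a + nv j + nv m = nv 1"
    unfolding a[symmetric] b[symmetric] by (simp add: ac_simps)
  ultimately show "\<exists>a\<ge>N. nv a + nv j + nv m = nv 1"
    by blast
qed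

lemma up_nv_1_not_nonneg: "\<not> 0 \<le> val up + nv 1"
  by (simp add: up_nv_nonneg_iff)

text \<open>The delicate case is Right replacing the far star by a small heap \<open>nim j\<close>: if Left had no
  answer, adding up the inequalities for two large heaps whose nim sum with \<open>j\<close> is 1 would give
  \<open>0 \<le> up + star\<close>, which is false.\<close>

lemma far_star_absorb:
  assumes "\<forall>\<^sub>F m in sequentially. 0 \<le> val d + val up + nv m"
  shows "((\<forall>\<^sub>F m in sequentially. 0 \<le> val y + nv m) \<longrightarrow>
            (\<forall>\<^sub>F m in sequentially. 0 \<le> val d + val y + nv m)) \<and>
         ((\<forall>\<^sub>F m in sequentially. \<not> val y + nv m \<le> 0) \<longrightarrow>
            (\<forall>\<^sub>F m in sequentially. \<not> val d + val y + nv m \<le> 0))"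
  using assms
proof (induction "size d + size y" arbitrary: d y rule: less_induct)
  case less
  obtain N1 where N1: "\<And>m. m \<ge> N1 \<Longrightarrow> 0 \<le> val d + val up + nv m"
    using less.prems by (auto simp: eventually_sequentially)
  have "\<forall>\<^sub>F m in sequentially. 0 \<le> val d + val y + nv m"
    if y: "\<forall>\<^sub>F m in sequentially. 0 \<le> val y + nv m"
  proof -
    obtain N2 where N2: "\<And>m. m \<ge> N2 \<Longrightarrow> 0 \<le> val y + nv m"
      using y by (auto simp: eventually_sequentially)
    have nim: "\<not> val d + val y + nv j \<le> 0" for j
    proof
      assume j: "val d + val y + nv j \<le> 0"
      obtain M where "\<And>m. m \<ge> M \<Longrightarrow> \<exists>a\<ge>N1. nv a + nv j + nv m = nv 1"
        using eventually_nim_balance[of N1 j] by (auto simp: eventually_sequentially)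
      then obtain a b where ab: "a \<ge> N1" "b \<ge> N2" "nv a + nv j + nv b = nv 1"
        by (meson max.cobounded1 max.cobounded2)
      have "0 \<le> (val d + val up + nv a) + (val y + nv b) + - (val d + val y + nv j)"
        using N1[OF ab(1)] N2[OF ab(2)] j by (rule nonneg_plus_minus_nonpos)
      also have "\<dots> = val up + (nv a + nv j + nv b)"
        by (simp add: algebra_simps)
      finally show False
        unfolding ab(3) using up_nv_1_not_nonneg by blast
    qed
    \<comment> \<open>Beside \<open>up\<close> and a far heap, Left has an answer to Right's move to
      \<open>g\<close>: in \<open>g\<close>, from \<open>up\<close> to 0, or in the heap. The last
      two yield a comparison at one fixed heap \<open>j\<close>, which a far heap beside
      \<open>y\<close> balances to \<open>nim 1\<close>. An answer \<open>l\<close> in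
      \<open>g\<close> that works for all large heaps inherits the hypothesis on \<open>d\<close>,
      so the induction applies to \<open>l\<close> and \<open>y\<close>.\<close>
    have right_d: "\<forall>\<^sub>F m in sequentially. \<not> val g + val y + nv m \<le> 0"
      if g: "g |\<in>| right_opts d" for g
    proof -
      have "\<forall>\<^sub>F m in sequentially. \<not> val (g + up) + nv m \<le> 0"
        using less.prems unfolding val_plus[of d up, symmetric] nonneg_plus_nv_iff[of "d + up"]
        by eventually_elim (use g in \<open>auto simp: right_opts_plus\<close>)
      then have ev: "\<forall>\<^sub>F m in sequentially. (\<exists>l\<in>fset (left_opts g). 0 \<le> val (l + up) + nv m) \<or>
          0 \<le> val g + nv m \<or> (\<exists>j. 0 \<le> val g + val up + nv j)"
        unfolding nonpos_plus_nv_iff[of "g + up"]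
        by eventually_elim (auto simp: left_opts_plus)
      consider j where "0 \<le> val g + val up + nv j" | j where "0 \<le> val g + nv j"
        | "\<forall>\<^sub>F m in sequentially. \<exists>l\<in>fset (left_opts g). 0 \<le> val (l + up) + nv m"
      proof (cases "\<exists>j. 0 \<le> val g + val up + nv j \<or> 0 \<le> val g + nv j")
        case False
        with ev have "\<forall>\<^sub>F m in sequentially. \<exists>l\<in>fset (left_opts g). 0 \<le> val (l + up) + nv m"
          by simp
        with that show ?thesis by blast
      qed (use that in blast)
      then show ?thesis
      proof cases
        case 1
        show ?thesis
          using eventually_nim_balance[of N2 j]
        proof eventually_elim
          case (elim m)
          then obtain a where a: "a \<ge> N2" "nv a + nv j + nv m = nv 1" by blast
          show ?case
          proof
            assume m: "val g + val y + nv m \<le> 0"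
            have "0 \<le> (val g + val up + nv j) + (val y + nv a) + - (val g + val y + nv m)"
              using 1 N2[OF a(1)] m by (rule nonneg_plus_minus_nonpos)
            also have "\<dots> = val up + (nv a + nv j + nv m)"
              by (simp add: algebra_simps)
            finally show False
              unfolding a(2) using up_nv_1_not_nonneg by blast
          qed
        qed
      next
        case 2
        show ?thesis
          using eventually_nim_balance[of N2 j]
        proof eventually_elim
          case (elim m)
          then obtain a where a: "a \<ge> N2" "nv a + nv j + nv m = nv 1" by blast
          show ?case
          proof
            assume m: "val g + val y + nv m \<le> 0"
            have "0 \<le> (val g + nv j) + (val y + nv a) + - (val g + val y + nv m)"
              using 2 N2[OF a(1)] m by (rule nonneg_plus_minus_nonpos)
            also have "\<dots> = nv a + nv j + nv m"
              by (simp add: algebra_simps)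
            finally show False
              unfolding a(2) using nv_fuzzy[of 1] by simp
          qed
        qed
      next
        case 3
        then have "\<exists>l\<in>fset (left_opts g). \<forall>\<^sub>F m in sequentially. 0 \<le> val (l + up) + nv m"
          by (rule far_star_pigeonhole)
        then obtain l where l: "l |\<in>| left_opts g"
          "\<forall>\<^sub>F m in sequentially. 0 \<le> val l + val up + nv m"
          by auto
        have "size l + size y < size d + size y"
          using size_left_opts[OF l(1)] size_right_opts[OF g] by simp
        from less.hyps[OF this l(2), THEN conjunct1, THEN mp, OF y] show ?thesis
        proof (rule eventually_mono)
          fix m
          assume "0 \<le> val l + val y + nv m"
          then have "0 \<le> val l + (val y + nv m)"
            by (simp only: add.assoc)
          from fuzzy_left_plusI[OF l(1) this val_plus[symmetric]]
          show "\<not> val g + val y + nv m \<le> 0"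
            by (simp only: add.assoc not_False_eq_True)
        qed
      qed
    qed
    \<comment> \<open>A move in \<open>y\<close> calls for the other half of the claim, with
      \<open>d\<close> unchanged.\<close>
    have right_y: "\<forall>\<^sub>F m in sequentially. \<not> val d + val g + nv m \<le> 0"
      if g: "g |\<in>| right_opts y" for g
    proof -
      have "\<forall>\<^sub>F m in sequentially. \<not> val g + nv m \<le> 0"
        using y unfolding nonneg_plus_nv_iff[of y] by eventually_elim (use g in blast)
      from less.hyps[OF _ less.prems, THEN conjunct2, THEN mp, OF _ this] show ?thesis
        using size_right_opts[OF g] by simp
    qed
    have "\<forall>\<^sub>F m in sequentially. \<forall>g\<in>fset (right_opts d). \<not> val g + val y + nv m \<le> 0"
      "\<forall>\<^sub>F m in sequentially. \<forall>g\<in>fset (right_opts y). \<not> val d + val g + nv m \<le> 0"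
      using right_d right_y by (intro eventually_ball_finite; simp)+
    then show ?thesis
      unfolding val_plus[of d y, symmetric] nonneg_plus_nv_iff[of "d + y"]
      by eventually_elim (use nim in \<open>auto simp: right_opts_plus\<close>)
  qed
  moreover have "\<forall>\<^sub>F m in sequentially. \<not> val d + val y + nv m \<le> 0"
    if y: "\<forall>\<^sub>F m in sequentially. \<not> val y + nv m \<le> 0"
  proof -
    \<comment> \<open>Left's winning opening beside the far star either reduces the heap to some
      fixed \<open>j\<close>, which is balanced against a far heap beside \<open>d + up\<close>, or
      is a fixed option \<open>l\<close> of \<open>y\<close>, which she also plays in
      \<open>d + y\<close>.\<close>
    have ev: "\<forall>\<^sub>F m in sequentially. (\<exists>l\<in>fset (left_opts y). 0 \<le> val l + nv m) \<or>
        (\<exists>j. 0 \<le> val y + nv j)"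
      using y unfolding nonpos_plus_nv_iff[of y] by eventually_elim blast
    consider j where "0 \<le> val y + nv j"
      | "\<forall>\<^sub>F m in sequentially. \<exists>l\<in>fset (left_opts y). 0 \<le> val l + nv m"
    proof (cases "\<exists>j. 0 \<le> val y + nv j")
      case False
      with ev have "\<forall>\<^sub>F m in sequentially. \<exists>l\<in>fset (left_opts y). 0 \<le> val l + nv m"
        by simp
      with that show ?thesis by blast
    qed (use that in blast)
    then show ?thesis
    proof cases
      case 1
      show ?thesis
        using eventually_nim_balance[of N1 j]
      proof eventually_elim
        case (elim m)
        then obtain a where a: "a \<ge> N1" "nv a + nv j + nv m = nv 1" by blast
        show ?case
        proof
          assume m: "val d + val y + nv m \<le> 0"
          have "0 \<le> (val d + val up + nv a) + (val y + nv j) + - (val d + val y + nv m)"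
            using N1[OF a(1)] 1 m by (rule nonneg_plus_minus_nonpos)
          also have "\<dots> = val up + (nv a + nv j + nv m)"
            by (simp add: algebra_simps)
          finally show False
            unfolding a(2) using up_nv_1_not_nonneg by blast
        qed
      qed
    next
      case 2
      then have "\<exists>l\<in>fset (left_opts y). \<forall>\<^sub>F m in sequentially. 0 \<le> val l + nv m"
        by (rule far_star_pigeonhole)
      then obtain l where l: "l |\<in>| left_opts y" "\<forall>\<^sub>F m in sequentially. 0 \<le> val l + nv m"
        by auto
      have "size d + size l < size d + size y"
        using size_left_opts[OF l(1)] by simp
      from less.hyps[OF this less.prems, THEN conjunct1, THEN mp, OF l(2)] show ?thesis
      proof (rule eventually_mono)
        fix m
        assume "0 \<le> val d + val l + nv m"
        then have "0 \<le> val l + (val d + nv m)"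
          by (simp only: ac_simps)
        from fuzzy_left_plusI[OF l(1) this val_plus[symmetric]]
        show "\<not> val d + val y + nv m \<le> 0"
          by (simp only: ac_simps not_False_eq_True)
      qed
    qed
  qed
  ultimately show ?case by blast
qed

section \<open>Atomic weight\<close>

lemma eventually_stable_iff:
  assumes "eventually P F \<or> (\<forall>\<^sub>F x in F. \<not> P x)" "eventually Q F \<or> (\<forall>\<^sub>F x in F. \<not> Q x)"
    and "eventually P F \<longleftrightarrow> eventually Q F"
  shows "\<forall>\<^sub>F x in F. P x \<longleftrightarrow> Q x"
proof (cases "eventually P F")
  case True
  with assms(3) have "eventually Q F" by blast
  with True show ?thesis by eventually_elim blast
next
  case False
  with assms have "\<forall>\<^sub>F x in F. \<not> P x" "\<forall>\<^sub>F x in F. \<not> Q x" by blast+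
  then show ?thesis by eventually_elim blast
qed

lemma far_star_equivalent_val:
  "far_star_equivalent G H \<longleftrightarrow> (\<forall>X. \<forall>\<^sub>F m in sequentially.
     (val G + val X + nv m \<le> 0 \<longleftrightarrow> val H + val X + nv m \<le> 0) \<and>
     (0 \<le> val G + val X + nv m \<longleftrightarrow> 0 \<le> val H + val X + nv m))"
  unfolding far_star_equivalent_def same_outcome_val val_plus ..

text \<open>The first bound lets \<open>far_star_absorb\<close> carry Left's wins from
  \<open>H + X\<close> to \<open>G + X\<close>, the second carries them back. Stability turns these
  implications between eventual statements into an eventual equivalence.\<close>

lemma far_star_equivalentI:
  assumes "\<forall>\<^sub>F m in sequentially. 0 \<le> val G - val H + val up + nv m"
    and "\<forall>\<^sub>F m in sequentially. 0 \<le> val H - val G + val up + nv m"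
  shows "far_star_equivalent G H"
  unfolding far_star_equivalent_val
proof
  fix X
  have absorb: "((\<forall>\<^sub>F m in sequentially. 0 \<le> val H + val X + nv m) \<longrightarrow>
        (\<forall>\<^sub>F m in sequentially. 0 \<le> val G + val X + nv m)) \<and>
      ((\<forall>\<^sub>F m in sequentially. \<not> val H + val X + nv m \<le> 0) \<longrightarrow>
        (\<forall>\<^sub>F m in sequentially. \<not> val G + val X + nv m \<le> 0))"
    if "\<forall>\<^sub>F m in sequentially. 0 \<le> val G - val H + val up + nv m" for G H
  proof -
    have *: "val (G + - H) = val G - val H" "val G - val H + (val H + val X) = val G + val X"
      by (simp_all add: algebra_simps)
    show ?thesis
      using far_star_absorb[of "G + - H" "H + X"] that unfolding *(1) val_plus[of H X] *(2) by blast
  qed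
  have stable: "((\<forall>\<^sub>F m in sequentially. 0 \<le> val G + val X + nv m) \<or>
        (\<forall>\<^sub>F m in sequentially. \<not> 0 \<le> val G + val X + nv m)) \<and>
      ((\<forall>\<^sub>F m in sequentially. val G + val X + nv m \<le> 0) \<or>
        (\<forall>\<^sub>F m in sequentially. \<not> val G + val X + nv m \<le> 0))" for G
    using far_star_stable[of "G + X"] unfolding val_plus .
  have not_ev: "\<not> (eventually P sequentially \<and> (\<forall>\<^sub>F m in sequentially. \<not> P m))" for P :: "nat \<Rightarrow> bool"
    using eventually_conj[of P sequentially "\<lambda>m. \<not> P m"] by auto
  have "\<forall>\<^sub>F m in sequentially. val G + val X + nv m \<le> 0 \<longleftrightarrow> val H + val X + nv m \<le> 0"
    using stable[of G] stable[of H] absorb[OF assms(1)] absorb[OF assms(2)] not_ev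
    by (intro eventually_stable_iff) blast+
  moreover have "\<forall>\<^sub>F m in sequentially. 0 \<le> val G + val X + nv m \<longleftrightarrow> 0 \<le> val H + val X + nv m"
    using stable[of G] stable[of H] absorb[OF assms(1)] absorb[OF assms(2)]
    by (intro eventually_stable_iff) blast+
  ultimately show "\<forall>\<^sub>F m in sequentially.
     (val G + val X + nv m \<le> 0 \<longleftrightarrow> val H + val X + nv m \<le> 0) \<and>
     (0 \<le> val G + val X + nv m \<longleftrightarrow> 0 \<le> val H + val X + nv m)"
    by (rule eventually_conj)
qed

lemma has_atomic_weightI:
  assumes "\<forall>\<^sub>F m in sequentially. 0 \<le> val G - ups (k - 1) + nv m"
    and "\<forall>\<^sub>F m in sequentially. val G - ups (k + 1) + nv m \<le> 0"
  shows "has_atomic_weight G k"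
  unfolding has_atomic_weight_def
proof (rule far_star_equivalentI)
  have "val G - ups (k - 1) = val G - ups k + val up"
    by (simp only: ups_diff ups_1 algebra_simps)
  then show "\<forall>\<^sub>F m in sequentially. 0 \<le> val G - ups k + val up + nv m"
    using assms(1) by (simp only:)
  have "ups k - val G + val up = - (val G - ups (k + 1))"
    by (simp only: val_int_mult_add ups_1 algebra_simps minus_diff_eq)
  then show "\<forall>\<^sub>F m in sequentially. 0 \<le> ups k - val G + val up + nv m"
    using assms(2) by (simp only: uminus_plus_nv_le)
qed

text \<open>The test position is arbitrary, so it can absorb first \<open>H\<close> and then the
  \<open>j\<close> multiples of \<open>up\<close>.\<close>

lemma has_atomic_weight_plus:
  assumes "has_atomic_weight G j" "has_atomic_weight H k"
  shows "has_atomic_weight (G + H) (j + k)"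
  unfolding has_atomic_weight_def far_star_equivalent_val
proof
  fix X
  have G: "val G + val (H + X) = val (G + H) + val X"
    "ups j + val (H + X) = val H + val (int_mult j up + X)"
    "ups k + val (int_mult j up + X) = ups (j + k) + val X"
    by (simp_all add: val_int_mult_add ac_simps)
  note 1 = assms(1)[unfolded has_atomic_weight_def far_star_equivalent_val, THEN spec, of "H + X", unfolded G]
  note 2 = assms(2)[unfolded has_atomic_weight_def far_star_equivalent_val, THEN spec, of "int_mult j up + X", unfolded G]
  from 1 2 show "\<forall>\<^sub>F m in sequentially.
     (val (G + H) + val X + nv m \<le> 0 \<longleftrightarrow> ups (j + k) + val X + nv m \<le> 0) \<and>
     (0 \<le> val (G + H) + val X + nv m \<longleftrightarrow> 0 \<le> ups (j + k) + val X + nv m)"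
    by (rule eventually_elim2) blast
qed

lemma ups_nv_not_nonpos:
  assumes "0 \<le> j" "m \<noteq> 0"
  shows "\<not> ups j + nv m \<le> 0"
proof
  assume "ups j + nv m \<le> 0"
  moreover have "nv m \<le> ups j + nv m"
    using ups_mono[OF assms(1)] by simp
  ultimately have "nv m \<le> 0"
    by (rule order_trans[rotated])
  with assms(2) show False
    using nv_fuzzy by blast
qed

lemma ups_nv_nonneg:
  assumes "1 \<le> j" "m \<noteq> 1"
  shows "0 \<le> ups j + nv m"
proof -
  have "0 \<le> val up + nv m"
    using assms(2) up_nv_nonneg_iff by blast
  also have "\<dots> \<le> ups j + nv m"
    using ups_mono[OF assms(1)] by simp
  finally show ?thesis .
qed

text \<open>Taking \<open>- i\<close> multiples of \<open>up\<close> as the test position reduces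
  far comparisons of \<open>G\<close> with multiples of \<open>up\<close> to comparisons among those
  multiples.\<close>

lemma has_atomic_weight_shift:
  assumes "has_atomic_weight G k"
  shows "\<forall>\<^sub>F m in sequentially. (val G - ups i + nv m \<le> 0 \<longleftrightarrow> ups (k - i) + nv m \<le> 0) \<and>
    (0 \<le> val G - ups i + nv m \<longleftrightarrow> 0 \<le> ups (k - i) + nv m)"
proof -
  have *: "x + ups (- i) = x - ups i" "ups k - ups i = ups (k - i)" for x
    by (simp_all add: ups_uminus ups_diff)
  show ?thesis
    using assms[unfolded has_atomic_weight_def far_star_equivalent_val, THEN spec, of "int_mult (- i) up"]
    unfolding * .
qed

lemma has_atomic_weight_not_nonpos:
  assumes "has_atomic_weight G k" "i \<le> k"
  shows "\<forall>\<^sub>F m in sequentially. \<not> val G - ups i + nv m \<le> 0"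
  using has_atomic_weight_shift[OF assms(1), of i] eventually_gt_at_top[of 0]
  by (rule eventually_elim2) (use ups_nv_not_nonpos[of "k - i"] assms(2) in auto)

lemma has_atomic_weight_nonneg:
  assumes "has_atomic_weight G k" "i < k"
  shows "\<forall>\<^sub>F m in sequentially. 0 \<le> val G - ups i + nv m"
  using has_atomic_weight_shift[OF assms(1), of i] eventually_gt_at_top[of 1]
  by (rule eventually_elim2) (use ups_nv_nonneg[of "k - i"] assms(2) in auto)

lemma has_atomic_weight_not_nonneg:
  assumes "has_atomic_weight G k" "k \<le> i"
  shows "\<forall>\<^sub>F m in sequentially. \<not> 0 \<le> val G - ups i + nv m"
proof (rule eventually_elim2[OF has_atomic_weight_shift[OF assms(1), of i] eventually_gt_at_top[of 0]])
  fix m :: nat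
  assume "0 < m"
  then have "\<not> ups (i - k) + nv m \<le> 0"
    using ups_nv_not_nonpos[of "i - k"] assms(2) by simp
  then have "\<not> 0 \<le> ups (k - i) + nv m"
    using uminus_plus_nv_le(1)[of "ups (i - k)" m] unfolding ups_uminus[symmetric] minus_diff_eq by blast
  then show "(val G - ups i + nv m \<le> 0 \<longleftrightarrow> ups (k - i) + nv m \<le> 0) \<and>
    (0 \<le> val G - ups i + nv m \<longleftrightarrow> 0 \<le> ups (k - i) + nv m) \<Longrightarrow> \<not> 0 \<le> val G - ups i + nv m"
    by blast
qed

lemma has_atomic_weight_nonpos:
  assumes "has_atomic_weight G k" "k < i"
  shows "\<forall>\<^sub>F m in sequentially. val G - ups i + nv m \<le> 0"
proof (rule eventually_elim2[OF has_atomic_weight_shift[OF assms(1), of i] eventually_gt_at_top[of 1]])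
  fix m :: nat
  assume "1 < m"
  then have "0 \<le> ups (i - k) + nv m"
    using ups_nv_nonneg[of "i - k"] assms(2) by simp
  then have "ups (k - i) + nv m \<le> 0"
    using uminus_plus_nv_le(2)[of "ups (i - k)" m] unfolding ups_uminus[symmetric] minus_diff_eq by blast
  then show "(val G - ups i + nv m \<le> 0 \<longleftrightarrow> ups (k - i) + nv m \<le> 0) \<and>
    (0 \<le> val G - ups i + nv m \<longleftrightarrow> 0 \<le> ups (k - i) + nv m) \<Longrightarrow> val G - ups i + nv m \<le> 0"
    by blast
qed

lemma has_atomic_weight_unique:
  assumes "has_atomic_weight G j" "has_atomic_weight G k"
  shows "j = k"
proof -
  have "\<not> j < k" if "has_atomic_weight G j" "has_atomic_weight G k" for j k
  proof
    assume "j < k"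
    from eventually_conj[OF has_atomic_weight_nonneg[OF that(2) this]
        has_atomic_weight_not_nonneg[OF that(1) order_refl]]
    show False by simp
  qed
  from this[OF assms] this[OF assms(2,1)] show ?thesis by simp
qed

text \<open>Otherwise \<open>m\<close> would be the nim sum of 1 and \<open>j\<close>, hence at most
  \<open>j + 1\<close>.\<close>

lemma nim_sum_not_one:
  assumes "j + 1 < m"
  obtains c where "nv m + nv j = nv c" "c \<noteq> 1"
proof -
  obtain c where c: "nv m + nv j = nv c"
    using nim_sum by blast
  have "c \<noteq> 1"
  proof
    assume "c = 1"
    with c have "nv m = nv 1 + nv j"
      by (metis add.assoc add.right_neutral nv_double(1))
    moreover obtain e where "e \<le> 1 + j" "nv 1 + nv j = nv e"
      using nim_sum by blast
    ultimately show False
      using assms by (auto simp: nv_inj)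
  qed
  with c that show thesis by blast
qed

lemma has_atomic_weight_nim: "has_atomic_weight (nim j) 0"
proof (rule has_atomic_weightI; rule eventually_sequentiallyI)
  fix m
  assume "j + 2 \<le> m"
  then obtain c where c: "nv m + nv j = nv c" "c \<noteq> 1"
    using nim_sum_not_one[of j m] by auto
  have pos: "0 \<le> val up + nv c"
    using c(2) up_nv_nonneg_iff by blast
  have "nv j - ups (0 - 1) + nv m = val up + nv c"
    unfolding c(1)[symmetric] by (simp add: ups_uminus algebra_simps)
  then show "0 \<le> nv j - ups (0 - 1) + nv m"
    using pos by (simp only:)
  have "nv j - ups (0 + 1) + nv m = - (val up + nv c)"
    unfolding c(1)[symmetric] by (simp add: algebra_simps)
  then show "nv j - ups (0 + 1) + nv m \<le> 0"
    using pos by (simp only: neg_le_0_iff_le)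
qed

text \<open>If it failed at \<open>j\<close>, comparing with the far inequality at some
  \<open>m > j\<close> would make \<open>nim m + nim j\<close> nonnegative, but distinct heaps are
  incomparable. So the conclusion reaches small heaps too.\<close>

lemma one_ahead:
  assumes "has_atomic_weight G k" "i < k"
  shows "\<not> val G - ups i + nv j \<le> 0"
proof
  assume j: "val G - ups i + nv j \<le> 0"
  obtain m where m: "m > j" "0 \<le> val G - ups i + nv m"
    using eventually_happens[OF eventually_conj[OF has_atomic_weight_nonneg[OF assms]
        eventually_gt_at_top[of j]]] by auto
  have "0 \<le> (val G - ups i + nv m) + 0 + - (val G - ups i + nv j)"
    using m(2) order_refl j by (rule nonneg_plus_minus_nonpos)
  also have "\<dots> = nv m + nv j"
    by (simp add: algebra_simps)
  finally show False
    using nv_sum_fuzzy(2)[of m j] m(1) by blast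
qed

text \<open>Passing from a far heap \<open>m\<close> to an arbitrary \<open>j\<close> costs
  \<open>nim m + nim j\<close>, a heap other than \<open>nim 1\<close>, and the second
  \<open>up\<close> of the margin pays for it.\<close>

lemma two_behind:
  assumes "has_atomic_weight G k" "k + 2 \<le> i"
  shows "val G - ups i + nv j \<le> 0"
proof -
  obtain m where m: "m > j + 1" "val G - ups (i - 1) + nv m \<le> 0"
    using eventually_happens[OF eventually_conj[OF has_atomic_weight_nonpos[OF assms(1), of "i - 1"]
        eventually_gt_at_top[of "j + 1"]]] assms(2) by auto
  obtain c where c: "nv m + nv j = nv c" "c \<noteq> 1"
    using nim_sum_not_one[OF m(1)] by blast
  have "0 \<le> 0 + (val up + nv c) + - (val G - ups (i - 1) + nv m)"
    using m(2) c(2) up_nv_nonneg_iff by (intro nonneg_plus_minus_nonpos) auto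
  also have "\<dots> = - (val G - ups i + nv j)"
    unfolding c(1)[symmetric] by (simp add: ups_diff algebra_simps)
  finally show ?thesis
    by (simp only: neg_0_le_iff_le)
qed

section \<open>Multiples of down as game trees\<close>

lemma val_downs: "val (nat_mult i (- up)) = - ups (int i)"
proof (induction i)
  case (Suc i)
  have "ups (int (Suc i)) = ups (int i) + val up"
    using val_int_mult_Suc[of "int i" up] by (simp only: of_nat_Suc add.commute)
  with Suc show ?case by simp
qed simp

text \<open>Which copy is moved affects the tree but not the value. Right turns one
  \<open>- up\<close> into 0; in the companion lemma Left turns one into
  \<open>star\<close>.\<close>

lemma right_opts_downs:
  "r |\<in>| right_opts (nat_mult i (- up)) \<Longrightarrow> \<exists>i'. i = Suc i' \<and> val r = - ups (int i')"
proof (induction i arbitrary: r)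
  case (Suc i)
  from Suc.prems consider "r = nat_mult i (- up)"
    | s where "s |\<in>| right_opts (nat_mult i (- up))" "r = - up + s"
    by (auto simp: right_opts_plus)
  then show ?case
  proof cases
    case 2
    with Suc.IH obtain i' where "i = Suc i'" "val s = - ups (int i')" by blast
    then show ?thesis
      using 2(2) val_downs[of i] val_downs[of i'] by simp
  qed (simp add: val_downs)
qed simp

lemma left_opts_downs:
  "l |\<in>| left_opts (nat_mult i (- up)) \<Longrightarrow> \<exists>i'. i = Suc i' \<and> val l = - ups (int i') + nv 1"
proof (induction i arbitrary: l)
  case (Suc i)
  from Suc.prems consider "l = nim 1 + nat_mult i (- up)"
    | s where "s |\<in>| left_opts (nat_mult i (- up))" "l = - up + s"
    by (auto simp: left_opts_plus)
  then show ?case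
  proof cases
    case 2
    with Suc.IH obtain i' where "i = Suc i'" "val s = - ups (int i') + nv 1" by blast
    then show ?thesis
      using 2(2) val_downs[of i] val_downs[of i'] by (simp add: algebra_simps)
  qed (simp add: val_downs add.commute)
qed simp

lemma left_opts_downs_Suc: "nim 1 + nat_mult i (- up) |\<in>| left_opts (nat_mult (Suc i) (- up))"
  by (simp add: left_opts_plus)

text \<open>The hypothesis \<open>first\<close> cannot be read off from the atomic weights of the options, as far
  star equivalence is blind to small heaps.\<close>

lemma has_atomic_weight_step:
  assumes "1 \<le> k"
    and right: "\<And>R. R |\<in>| right_opts G \<Longrightarrow> \<exists>r\<ge>k - 1. has_atomic_weight R r"
    and least: "\<exists>R. R |\<in>| right_opts G \<and> has_atomic_weight R (k - 1)"
    and left: "\<And>L. L |\<in>| left_opts G \<Longrightarrow> \<exists>l\<le>k + 1. has_atomic_weight L l"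
    and first: "\<And>j. \<not> val G + nv j \<le> 0"
  shows "has_atomic_weight G k"
proof (rule has_atomic_weightI)
  \<comment> \<open>Kept as a tree because the argument plays through its options.\<close>
  define y where "y i = G + nat_mult i (- up)" for i
  have y: "val (y i) = val G - ups (int i)" for i
    by (simp add: y_def val_downs)
  have right_y: "(\<exists>R. R |\<in>| right_opts G \<and> val r = val R - ups (int i)) \<or>
      (\<exists>i'. i = Suc i' \<and> val r = val (y i'))" if "r |\<in>| right_opts (y i)" for r i
    using that right_opts_downs[of _ i] unfolding y_def
    by (fastforce simp: right_opts_plus val_downs)
  have left_y: "(\<exists>L. L |\<in>| left_opts G \<and> val l = val L - ups (int i)) \<or>
      (\<exists>i'. i = Suc i' \<and> val l = val (y i') + nv 1)" if "l |\<in>| left_opts (y i)" for l i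
    using that left_opts_downs[of _ i] unfolding y_def
    by (fastforce simp: left_opts_plus val_downs add.assoc)
  \<comment> \<open>Left's opening turns one \<open>- up\<close> into \<open>star\<close>, which
    merges with \<open>nim j\<close> into another heap, and the second claim for
    \<open>i - 1\<close> takes over; \<open>first\<close> starts this at \<open>i = 0\<close>. When
    Right starts, his options in \<open>G\<close> have weight at least \<open>k - 1 > i\<close>, so
    \<open>one_ahead\<close> applies.\<close>
  have lower: "(int i < k \<longrightarrow> (\<forall>j. \<not> val (y i) + nv j \<le> 0)) \<and>
      (int i + 2 \<le> k \<longrightarrow> (\<forall>j. 0 \<le> val (y i) + nv j))" for i
  proof (induction i rule: less_induct)
    case i: (less i)
    have one: "\<not> val (y i) + nv j \<le> 0" if "int i < k" for j
    proof (cases i)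
      case 0
      then show ?thesis using first by (simp add: y_def)
    next
      case (Suc i')
      obtain c where c: "nv 1 + nv j = nv c"
        using nim_sum by blast
      have "0 \<le> val (y i') + nv c"
        using i[of i'] Suc that by simp
      then have "0 \<le> val (G + (nim 1 + nat_mult i' (- up))) + nv j"
        by (simp only: c[symmetric] y_def val_plus ac_simps)
      moreover have "G + (nim 1 + nat_mult i' (- up)) |\<in>| left_opts (y i)"
        unfolding y_def Suc left_opts_plus using left_opts_downs_Suc[of i'] by blast
      ultimately show ?thesis
        by (rule fuzzy_left_plusI[OF _ _ refl, rotated])
    qed
    moreover have "0 \<le> val (y i) + nv j" if "int i + 2 \<le> k" for j
      unfolding nonneg_plus_nv_iff[of "y i"]
    proof (intro conjI allI impI ballI)
      fix r
      assume "r |\<in>| right_opts (y i)"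
      with right_y consider R where "R |\<in>| right_opts G" "val r = val R - ups (int i)"
        | i' where "i = Suc i'" "val r = val (y i')" by blast
      then show "\<not> val r + nv j \<le> 0"
      proof cases
        case 1
        obtain s where "s \<ge> k - 1" "has_atomic_weight R s"
          using right[OF 1(1)] by blast
        then show ?thesis
          unfolding 1(2) using one_ahead[of R s "int i"] that by simp
      next
        case 2
        then show ?thesis
          using i[of i'] that by simp
      qed
    next
      show "\<not> val (y i) + nv j' \<le> 0" for j'
        using one[of j'] that by simp
    qed
    ultimately show ?case by blast
  qed
  \<comment> \<open>Here a Right option of \<open>G\<close> may have weight exactly
    \<open>i\<close>, so \<open>one_ahead\<close> is out of reach and only far heaps are
    controlled.\<close>
  define i where "i = nat (k - 1)"
  have i: "int i = k - 1"
    using assms(1) by (simp add: i_def)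
  have "\<forall>\<^sub>F m in sequentially. \<forall>r\<in>fset (right_opts (y i)). \<not> val r + nv m \<le> 0"
  proof (intro eventually_ball_finite finite_fset ballI)
    fix r
    assume "r |\<in>| right_opts (y i)"
    with right_y consider R where "R |\<in>| right_opts G" "val r = val R - ups (int i)"
      | i' where "i = Suc i'" "val r = val (y i')" by blast
    then show "\<forall>\<^sub>F m in sequentially. \<not> val r + nv m \<le> 0"
    proof cases
      case 1
      obtain s where s: "s \<ge> k - 1" "has_atomic_weight R s"
        using right[OF 1(1)] by blast
      show ?thesis
        unfolding 1(2) by (rule has_atomic_weight_not_nonpos[OF s(2)]) (use s(1) i in simp)
    next
      case 2
      have "\<not> val (y i') + nv m \<le> 0" for m
        using lower[of i'] 2(1) i by simp
      then show ?thesis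
        unfolding 2(2) by (intro always_eventually allI)
    qed
  qed
  then have "\<forall>\<^sub>F m in sequentially. 0 \<le> val (y i) + nv m"
  proof (rule eventually_mono)
    fix m
    assume "\<forall>r\<in>fset (right_opts (y i)). \<not> val r + nv m \<le> 0"
    moreover have "\<not> val (y i) + nv j \<le> 0" for j
      using lower[of i] i by simp
    ultimately show "0 \<le> val (y i) + nv m"
      unfolding nonneg_plus_nv_iff[of "y i"] by blast
  qed
  then show "\<forall>\<^sub>F m in sequentially. 0 \<le> val G - ups (k - 1) + nv m"
    unfolding y i .
next
  \<comment> \<open>Right answers every move of Left outside \<open>G\<close> by moving to
    \<open>R\<close>. Its weight \<open>k - 1\<close> is two behind \<open>k + 1\<close>, enough
    even if Left has reduced the far star to a small heap.\<close>
  obtain R where R: "R |\<in>| right_opts G" "has_atomic_weight R (k - 1)"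
    using least by blast
  define i where "i = nat (k + 1)"
  define y where "y = G + nat_mult i (- up)"
  have i: "int i = k + 1" "i = Suc (nat k)" "int (nat k) = k"
    using assms(1) by (simp_all add: i_def nat_add_distrib)
  have y: "val y = val G - ups (k + 1)"
    by (simp add: y_def val_downs i(1))
  have "\<forall>\<^sub>F m in sequentially. \<forall>l\<in>fset (left_opts y). \<not> 0 \<le> val l + nv m"
  proof (intro eventually_ball_finite finite_fset ballI)
    fix l
    assume "l |\<in>| left_opts y"
    then consider L where "L |\<in>| left_opts G" "val l = val L - ups (k + 1)"
      | s where "s |\<in>| left_opts (nat_mult i (- up))" "val l = val G + val s"
      unfolding y_def by (auto simp: left_opts_plus val_downs i(1) simp del: nat_mult.simps)
    then show "\<forall>\<^sub>F m in sequentially. \<not> 0 \<le> val l + nv m"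
    proof cases
      case 1
      then obtain s where s: "s \<le> k + 1" "has_atomic_weight L s"
        using left by blast
      show ?thesis
        unfolding 1(2) by (rule has_atomic_weight_not_nonneg[OF s(2,1)])
    next
      case 2
      then have l: "val l = val G + (- ups k + nv 1)"
        using left_opts_downs[OF 2(1)] i(2,3) by auto
      \<comment> \<open>Left has turned one \<open>- up\<close> into \<open>star\<close>, so
        \<open>R\<close> faces only \<open>k\<close> copies. The \<open>star\<close> merges with the
        far heap \<open>m\<close> into some \<open>c \<ge> m - 1\<close>, which is still
        far.\<close>
      obtain N where N: "\<And>m. m \<ge> N \<Longrightarrow> val R - ups k + nv m \<le> 0"
        using has_atomic_weight_nonpos[OF R(2), of k] by (auto simp: eventually_sequentially)
      show ?thesis
      proof (rule eventually_sequentiallyI)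
        fix m
        assume m: "N + 1 \<le> m"
        obtain c where c: "nv 1 + nv m = nv c"
          using nim_sum by blast
        obtain e where e: "nv 1 + nv c = nv e" "e \<le> 1 + c"
          using nim_sum by blast
        have "nv e = nv m"
          unfolding e(1)[symmetric] c[symmetric] by (simp only: nv_double)
        with m e(2) have "N \<le> c"
          by (simp add: nv_inj)
        from N[OF this] have "val R + (- ups k + nv 1 + nv m) \<le> 0"
          unfolding c[symmetric] by (simp only: diff_conv_add_uminus add.assoc)
        moreover have "- ups k + nv 1 + nv m = val (int_mult (- k) up + nim 1 + nim m)"
          by (simp add: ups_uminus)
        ultimately show "\<not> 0 \<le> val l + nv m"
          unfolding l using fuzzy_right_plusI[OF R(1)] by (metis add.assoc)
      qed
    qed
  qed
  then have "\<forall>\<^sub>F m in sequentially. val y + nv m \<le> 0"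
  proof (rule eventually_mono)
    fix m
    assume "\<forall>l\<in>fset (left_opts y). \<not> 0 \<le> val l + nv m"
    moreover have "\<not> 0 \<le> val y + nv j" for j
    proof -
      have "val R + (- ups (k + 1) + nv j) \<le> 0"
        using two_behind[OF R(2), of "k + 1" j] by (simp only: diff_conv_add_uminus add.assoc)
      moreover have "- ups (k + 1) + nv j = val (int_mult (- (k + 1)) up + nim j)"
        by (simp only: ups_uminus val_plus)
      ultimately show ?thesis
        unfolding y using fuzzy_right_plusI[OF R(1)] by (metis add.assoc diff_conv_add_uminus)
    qed
    ultimately show "val y + nv m \<le> 0"
      unfolding nonpos_plus_nv_iff[of y] by blast
  qed
  then show "\<forall>\<^sub>F m in sequentially. val G - ups (k + 1) + nv m \<le> 0"
    unfolding y .
qed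

section \<open>Deletions on paths\<close>

lemma mem_fimage: "y |\<in>| g |`| A \<longleftrightarrow> (\<exists>x. x |\<in>| A \<and> y = g x)"
  by auto

lemma ffilter_fimage: "ffilter P (g |`| A) = g |`| ffilter (\<lambda>x. P (g x)) A"
  by (intro fset_eqI; unfold ffmember_filter mem_fimage) blast

lemma mem_edges_map_graph:
  "e' |\<in>| edges (map_graph g G) \<longleftrightarrow> (\<exists>e. e' = g |`| e \<and> e |\<in>| edges G)"
  by (cases G) auto

context
  fixes f :: "'a \<Rightarrow> 'b"
  assumes f: "inj f"
begin

lemma mem_fimage_inj: "f x |\<in>| f |`| A \<longleftrightarrow> x |\<in>| A"
  using f by (auto dest: injD)

lemma fimage_inj_eq: "f |`| A = f |`| B \<longleftrightarrow> A = B"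
  using mem_fimage_inj by (metis fset_eqI)

lemma delete_vertex_map_graph:
  "delete_vertex (map_graph f G) (f v) = map_graph f (delete_vertex G v)"
proof (rule graph.expand, intro conjI)
  show "verts (delete_vertex (map_graph f G) (f v)) = verts (map_graph f (delete_vertex G v))"
    using f by (auto simp: delete_vertex_def graph.map_sel dest: injD)
  show "edges (delete_vertex (map_graph f G) (f v)) = edges (map_graph f (delete_vertex G v))"
    by (simp only: delete_vertex_def graph.map_sel graph.sel ffilter_fimage mem_fimage_inj)
qed

lemma delete_edge_map_graph:
  "delete_edge (map_graph f G) (f |`| e) = map_graph f (delete_edge G e)"
  by (cases G) (auto simp: delete_edge_def fimage_inj_eq)

lemma isolated_map_graph: "isolated (map_graph f G) w \<longleftrightarrow> (\<exists>v. w = f v \<and> isolated G v)"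
  by (cases G) (auto simp: isolated_def mem_fimage_inj dest: injD[OF f])

lemma creates_isolated_map_graph:
  "creates_isolated (map_graph f G) (map_graph f H) \<longleftrightarrow> creates_isolated G H"
  using f unfolding creates_isolated_def isolated_map_graph by (auto dest: injD)

lemma left_safe_map_graph: "left_safe (map_graph f G) w \<longleftrightarrow> (\<exists>v. w = f v \<and> left_safe G v)"
proof -
  have "w |\<in>| verts (map_graph f G) \<longleftrightarrow> (\<exists>v. w = f v \<and> v |\<in>| verts G)"
    by (cases G) auto
  then show ?thesis
    unfolding left_safe_def by (metis creates_isolated_map_graph delete_vertex_map_graph)
qed

lemma right_safe_map_graph:
  "right_safe (map_graph f G) e' \<longleftrightarrow> (\<exists>e. e' = f |`| e \<and> right_safe G e)"
proof -
  show ?thesis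
    unfolding right_safe_def mem_edges_map_graph
    by (metis creates_isolated_map_graph delete_edge_map_graph)
qed

lemma live_map_graph: "live (map_graph f G) \<longleftrightarrow> live G"
  unfolding live_def left_safe_map_graph right_safe_map_graph by blast

lemma connected_to_map_graph:
  "connected_to (map_graph f G) (f v) w \<longleftrightarrow> (\<exists>u. w = f u \<and> connected_to G v u)"
proof
  have edge: "{|f x, f y|} |\<in>| edges (map_graph f G) \<longleftrightarrow> {|x, y|} |\<in>| edges G" for x y
  proof -
    have "{|f x, f y|} = f |`| {|x, y|}" by simp
    then show ?thesis
      by (cases G) (auto simp: fimage_inj_eq simp del: fimage_finsert)
  qed
  {
    assume "connected_to (map_graph f G) (f v) w"
    then show "\<exists>u. w = f u \<and> connected_to G v u"
      unfolding connected_to_def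
    proof (induction rule: rtrancl_induct)
      case (step y z)
      then obtain u where u: "y = f u" "(v, u) \<in> {(x, y). {|x, y|} |\<in>| edges G}\<^sup>*"
        by blast
      have "z |\<in>| {|y, z|}" by simp
      with step(2) obtain t where t: "z = f t"
        by (cases G) force
      with step(2) u edge have "{|u, t|} |\<in>| edges G" by simp
      with u t show ?case
        by (auto intro: rtrancl.rtrancl_into_rtrancl)
    qed blast
  }
  assume "\<exists>u. w = f u \<and> connected_to G v u"
  then obtain u where "w = f u" and u: "(v, u) \<in> {(x, y). {|x, y|} |\<in>| edges G}\<^sup>*"
    by (auto simp: connected_to_def)
  from u have "(f v, f u) \<in> {(x, y). {|x, y|} |\<in>| edges (map_graph f G)}\<^sup>*"
    by (induction rule: rtrancl_induct) (auto simp: edge intro: rtrancl.rtrancl_into_rtrancl)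
  with \<open>w = f u\<close> show "connected_to (map_graph f G) (f v) w"
    by (simp add: connected_to_def)
qed

lemma component_map_graph: "component (map_graph f G) (f v) = map_graph f (component G v)"
proof -
  have conn: "connected_to (map_graph f G) (f v) (f u) \<longleftrightarrow> connected_to G v u" for u
    using f by (auto simp: connected_to_map_graph dest: injD)
  have "(\<exists>w. w |\<in>| f |`| e \<and> connected_to (map_graph f G) (f v) w) \<longleftrightarrow>
      (\<exists>w. w |\<in>| e \<and> connected_to G v w)" for e
    by (auto simp: conn)
  then show ?thesis
    by (simp only: component_def graph.map_sel graph.sel ffilter_fimage conn graph.map)
qed

text \<open>The right-hand piece of a cut path is labelled from a positive number on, so positions
  must be shown independent of labels. Every ingredient of the recursion of \<open>position\<close>
  commutes with an injection.\<close>

lemma position_map_graph: "position (map_graph f G) = position G"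
proof (induction "fcard (verts G) + fcard (edges G)" arbitrary: G rule: less_induct)
  case less
  have left: "left_available (map_graph f G) (f v) \<longleftrightarrow> left_available G v" for v
    using f unfolding left_available_def left_safe_map_graph component_map_graph live_map_graph
    by (auto dest: injD)
  have right: "right_available (map_graph f G) (f |`| e) \<longleftrightarrow> right_available G e" for e
    unfolding right_available_def right_safe_map_graph
    by (auto simp: fimage_inj_eq component_map_graph live_map_graph)
  have "(\<lambda>v. position (delete_vertex (map_graph f G) (f v))) |`| ffilter (left_available G) (verts G) =
      (\<lambda>v. position (delete_vertex G v)) |`| ffilter (left_available G) (verts G)"
  proof (intro fimage_cong refl)
    fix v
    assume "v |\<in>| ffilter (left_available G) (verts G)"
    then have "fcard (verts (delete_vertex G v)) < fcard (verts G)"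
      by (metis delete_vertex_def fcard_fminus1_less ffmember_filter graph.sel(1))
    moreover have "fcard (edges (delete_vertex G v)) \<le> fcard (edges G)"
      by (auto simp: delete_vertex_def intro!: fcard_mono)
    ultimately show "position (delete_vertex (map_graph f G) (f v)) = position (delete_vertex G v)"
      unfolding delete_vertex_map_graph by (intro less) simp
  qed
  moreover have "(\<lambda>e. position (delete_edge (map_graph f G) (f |`| e))) |`| ffilter (right_available G) (edges G) =
      (\<lambda>e. position (delete_edge G e)) |`| ffilter (right_available G) (edges G)"
  proof (intro fimage_cong refl)
    fix e
    assume "e |\<in>| ffilter (right_available G) (edges G)"
    then have "fcard (edges (delete_edge G e)) < fcard (edges G)"
      by (metis delete_edge_def fcard_fminus1_less ffmember_filter graph.sel(2))
    then show "position (delete_edge (map_graph f G) (f |`| e)) = position (delete_edge G e)"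
      unfolding delete_edge_map_graph by (intro less) (simp add: delete_edge_def)
  qed
  moreover have "ffilter (left_available (map_graph f G)) (verts (map_graph f G)) =
      f |`| ffilter (left_available G) (verts G)"
    "ffilter (right_available (map_graph f G)) (edges (map_graph f G)) =
      (|`|) f |`| ffilter (right_available G) (edges G)"
    by (auto simp: graph.map_sel left right simp del: fimage_iff)
  ultimately show ?case
    unfolding position.simps[of "map_graph f G"] position.simps[of G]
    by (simp only: fset.map_comp o_def)
qed

lemma simple_graph_map_graph: "simple_graph G \<Longrightarrow> simple_graph (map_graph f G)"
proof -
  have "fcard (f |`| e) = fcard e" for e
    using f by (auto simp: fcard.rep_eq intro!: card_image inj_on_subset[OF f])
  then show "simple_graph G \<Longrightarrow> simple_graph (map_graph f G)"
    by (cases G) (auto simp: simple_graph_def)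
qed

end

section \<open>Cutting a path in two\<close>

lemma verts_path_graph [simp]: "x |\<in>| verts (path_graph n) \<longleftrightarrow> x < n"
  by (simp add: path_graph_def fset_of_list_elem)

lemma edge_eq_iff [simp]: "{|i, Suc i|} = {|j, Suc j|} \<longleftrightarrow> i = j"
proof
  assume "{|i, Suc i|} = {|j, Suc j|}"
  then have "i |\<in>| {|j, Suc j|}" "Suc i |\<in>| {|j, Suc j|}" by auto
  then show "i = j" by auto
qed simp

lemma edges_path_graph: "e |\<in>| edges (path_graph n) \<longleftrightarrow> (\<exists>i. Suc i < n \<and> e = {|i, Suc i|})"
  by (auto simp: path_graph_def fset_of_list_elem image_iff)

abbreviation shifted_path :: "nat \<Rightarrow> nat \<Rightarrow> nat graph" where
  "shifted_path k n \<equiv> map_graph ((+) k) (path_graph n)"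

lemma verts_shifted_path: "x |\<in>| verts (shifted_path k n) \<longleftrightarrow> k \<le> x \<and> x < k + n"
proof -
  have "x |\<in>| verts (shifted_path k n) \<longleftrightarrow> (\<exists>y<n. x = k + y)"
    by (auto simp: graph.map_sel)
  then show ?thesis
    by (metis le_add1 le_add_diff_inverse nat_add_left_cancel_less)
qed

lemma edges_shifted_path:
  "e |\<in>| edges (shifted_path k n) \<longleftrightarrow> (\<exists>i\<ge>k. Suc i < k + n \<and> e = {|i, Suc i|})"
proof -
  have "e |\<in>| edges (shifted_path k n) \<longleftrightarrow> (\<exists>i. Suc i < n \<and> e = {|k + i, Suc (k + i)|})"
  proof -
    have "(+) k |`| {|i, Suc i|} = {|k + i, Suc (k + i)|}" for i
      by simp
    then show ?thesis
      unfolding mem_edges_map_graph edges_path_graph by metis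
  qed
  then show ?thesis
    by (metis add_Suc_right le_add1 le_add_diff_inverse nat_add_left_cancel_less)
qed

lemma graph_eqI: "verts G = verts H \<Longrightarrow> edges G = edges H \<Longrightarrow> G = H"
  by (cases G; cases H) simp

text \<open>Vertices are numbered from 0, so exactly \<open>a\<close> of them precede vertex
  \<open>a\<close>.\<close>

lemma delete_vertex_path_graph:
  "delete_vertex (path_graph (a + b + 1)) a = graph_union (path_graph a) (shifted_path (a + 1) b)"
proof (rule graph_eqI)
  show "verts (delete_vertex (path_graph (a + b + 1)) a) =
      verts (graph_union (path_graph a) (shifted_path (a + 1) b))"
    by (intro fset_eqI) (auto simp: delete_vertex_def graph_union_def verts_shifted_path)
  have split: "Suc i < a + b + 1 \<and> a \<noteq> i \<and> a \<noteq> Suc i \<longleftrightarrow>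
      Suc i < a \<or> (a + 1 \<le> i \<and> Suc i < a + 1 + b)" for i
    by linarith
  show "edges (delete_vertex (path_graph (a + b + 1)) a) =
      edges (graph_union (path_graph a) (shifted_path (a + 1) b))"
  proof (intro fset_eqI)
    fix e
    have "e |\<in>| edges (delete_vertex (path_graph (a + b + 1)) a) \<longleftrightarrow>
        (\<exists>i. (Suc i < a + b + 1 \<and> a \<noteq> i \<and> a \<noteq> Suc i) \<and> e = {|i, Suc i|})"
      unfolding delete_vertex_def graph.sel ffmember_filter edges_path_graph
      by (metis finsert_iff fempty_iff)
    also have "\<dots> \<longleftrightarrow> e |\<in>| edges (graph_union (path_graph a) (shifted_path (a + 1) b))"
      unfolding split graph_union_def graph.sel funion_iff edges_path_graph edges_shifted_path
      by blast
    finally show "e |\<in>| edges (delete_vertex (path_graph (a + b + 1)) a) \<longleftrightarrow>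
        e |\<in>| edges (graph_union (path_graph a) (shifted_path (a + 1) b))" .
  qed
qed

lemma delete_edge_path_graph:
  assumes "1 \<le> a" "1 \<le> b"
  shows "delete_edge (path_graph (a + b)) {|a - 1, Suc (a - 1)|} =
    graph_union (path_graph a) (shifted_path a b)"
proof (rule graph_eqI)
  show "verts (delete_edge (path_graph (a + b)) {|a - 1, Suc (a - 1)|}) =
      verts (graph_union (path_graph a) (shifted_path a b))"
    by (intro fset_eqI) (auto simp: delete_edge_def graph_union_def verts_shifted_path)
  have "Suc i < a + b \<and> i \<noteq> a - 1 \<longleftrightarrow> Suc i < a \<or> (a \<le> i \<and> Suc i < a + b)" for i
    using assms by linarith
  then show "edges (delete_edge (path_graph (a + b)) {|a - 1, Suc (a - 1)|}) =
      edges (graph_union (path_graph a) (shifted_path a b))"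
    unfolding delete_edge_def graph_union_def graph.sel
    by (intro fset_eqI; unfold fminus_iff finsert_iff funion_iff edges_path_graph edges_shifted_path)
      (metis edge_eq_iff fempty_iff)
qed

lemma isolated_path_graph: "isolated (path_graph n) x \<longleftrightarrow> n = 1 \<and> x = 0"
proof
  assume iso: "isolated (path_graph n) x"
  then have "x < n" and no: "Suc i < n \<Longrightarrow> x \<noteq> i \<and> x \<noteq> Suc i" for i
    by (auto simp: isolated_def edges_path_graph)
  have "x = 0"
    using no[of "x - 1"] \<open>x < n\<close> by (cases x) auto
  moreover have "\<not> Suc x < n"
    using no by blast
  ultimately show "n = 1 \<and> x = 0"
    using \<open>x < n\<close> by simp
qed (auto simp: isolated_def edges_path_graph)

lemma isolated_two_paths:
  assumes "a \<le> k"
  shows "(\<exists>x. isolated (graph_union (path_graph a) (shifted_path k b)) x) \<longleftrightarrow> a = 1 \<or> b = 1"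
proof -
  have "verts (path_graph a) |\<inter>| verts (shifted_path k b) = {||}"
    using assms by (intro fset_eqI) (auto simp: verts_shifted_path)
  from isolated_graph_union[OF simple_graph_path_graph simple_graph_map_graph[OF _ simple_graph_path_graph] this]
  show ?thesis
    by (auto simp: isolated_map_graph isolated_path_graph)
qed

lemma position_two_paths:
  assumes "a \<le> k"
  shows "position (graph_union (path_graph a) (shifted_path k b)) =
    position (path_graph a) + position (path_graph b)"
proof -
  have "verts (path_graph a) |\<inter>| verts (shifted_path k b) = {||}"
    using assms by (intro fset_eqI) (auto simp: verts_shifted_path)
  then show ?thesis
    by (subst position_graph_union)
      (simp_all add: simple_graph_path_graph simple_graph_map_graph position_map_graph)
qed

text \<open>For \<open>a + b = 0\<close> the only vertex was isolated already, so its deletion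
  creates nothing. Otherwise the path has no isolated vertex, and a piece does harm exactly if it is
  a single vertex.\<close>

lemma left_safe_path_graph:
  "left_safe (path_graph (a + b + 1)) a \<longleftrightarrow> a + b = 0 \<or> a \<noteq> 1 \<and> b \<noteq> 1"
proof (cases "a + b = 0")
  case True
  then show ?thesis
    by (auto simp: left_safe_def creates_isolated_def isolated_def delete_vertex_def)
next
  case False
  then show ?thesis
    using isolated_two_paths[of a "a + 1" b]
    by (auto simp: left_safe_def creates_isolated_def isolated_path_graph delete_vertex_path_graph
        simp del: One_nat_def add_Suc_right)
qed

lemma right_safe_path_graph:
  assumes "1 \<le> a" "1 \<le> b"
  shows "right_safe (path_graph (a + b)) {|a - 1, Suc (a - 1)|} \<longleftrightarrow> a \<noteq> 1 \<and> b \<noteq> 1"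
proof -
  have "{|a - 1, Suc (a - 1)|} |\<in>| edges (path_graph (a + b))"
    unfolding edges_path_graph using assms by (intro exI[of _ "a - 1"]) simp
  moreover have "\<not> isolated (path_graph (a + b)) x" for x
    using assms by (simp add: isolated_path_graph)
  ultimately show ?thesis
    using isolated_two_paths[of a a b]
    unfolding right_safe_def creates_isolated_def delete_edge_path_graph[OF assms] by blast
qed

lemma component_path_graph:
  assumes "v < n"
  shows "component (path_graph n) v = path_graph n"
proof -
  have zero: "connected_to (path_graph n) 0 w" if "w < n" for w
    using that
  proof (induction w)
    case (Suc w)
    then have "connected_to (path_graph n) w (Suc w)"
      unfolding connected_to_def by (intro r_into_rtrancl) (auto simp: edges_path_graph)
    with Suc show ?case
      by (meson Suc_lessD connected_to_trans)
  qed simp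
  then have conn: "connected_to (path_graph n) v w" if "w < n" for w
    using assms that by (meson connected_to_sym connected_to_trans)
  show ?thesis
  proof (rule graph_eqI)
    show "verts (component (path_graph n) v) = verts (path_graph n)"
      by (intro fset_eqI) (auto simp: component_def conn)
    have "\<exists>w. w |\<in>| e \<and> connected_to (path_graph n) v w"
      if e: "e |\<in>| edges (path_graph n)" for e
    proof -
      obtain i where "Suc i < n" "e = {|i, Suc i|}"
        using e unfolding edges_path_graph by blast
      then show ?thesis
        using conn[of i] by auto
    qed
    then show "edges (component (path_graph n) v) = edges (path_graph n)"
      unfolding component_def graph.sel by (intro fset_eqI; unfold ffmember_filter) blast
  qed
qed

lemma edge_path_graphE:
  assumes "e |\<in>| edges (path_graph n)"
  obtains a b where "n = a + b" "1 \<le> a" "1 \<le> b" "e = {|a - 1, Suc (a - 1)|}"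
proof -
  obtain i where "Suc i < n" "e = {|i, Suc i|}"
    using assms unfolding edges_path_graph by blast
  then show ?thesis
    by (intro that[of "Suc i" "n - Suc i"]) auto
qed

text \<open>Right is the bottleneck: both pieces of his cut need two vertices, while Left can safely
  remove an end vertex already from three.\<close>

lemma live_path_graph: "live (path_graph n) \<longleftrightarrow> 4 \<le> n"
proof
  assume "live (path_graph n)"
  then obtain e where e: "right_safe (path_graph n) e"
    by (auto simp: live_def)
  then obtain a b where "n = a + b" "1 \<le> a" "1 \<le> b" "e = {|a - 1, Suc (a - 1)|}"
    by (auto simp: right_safe_def elim: edge_path_graphE)
  with e right_safe_path_graph[of a b] show "4 \<le> n" by simp
next
  assume n: "4 \<le> n"
  then have "n = 0 + (n - 1) + 1" "n = 2 + (n - 2)" by simp_all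
  then have "left_safe (path_graph n) 0" "right_safe (path_graph n) {|2 - 1, Suc (2 - 1)|}"
    using left_safe_path_graph[of 0 "n - 1"] right_safe_path_graph[of 2 "n - 2"] n by auto
  then show "live (path_graph n)"
    by (auto simp: live_def)
qed

abbreviation path_game :: "nat \<Rightarrow> game" where
  "path_game n \<equiv> position (path_graph n)"

text \<open>The bound \<open>4 \<le> n\<close> is the mutual failures condition; for Right the sizes
  of his two pieces imply it.\<close>

lemma left_opts_path_game:
  "g |\<in>| left_opts (path_game n) \<longleftrightarrow>
    4 \<le> n \<and> (\<exists>a b. n = a + b + 1 \<and> a \<noteq> 1 \<and> b \<noteq> 1 \<and> g = path_game a + path_game b)"
proof -
  have "g |\<in>| left_opts (path_game n) \<longleftrightarrow>
      (\<exists>v<n. left_available (path_graph n) v \<and> g = position (delete_vertex (path_graph n) v))"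
    by (subst position.simps) auto
  also have "\<dots> \<longleftrightarrow> (\<exists>a b. n = a + b + 1 \<and> left_available (path_graph n) a \<and>
      g = position (delete_vertex (path_graph n) a))"
    by (metis add.assoc add.commute less_iff_Suc_add Suc_eq_plus1)
  also have "\<dots> \<longleftrightarrow> 4 \<le> n \<and> (\<exists>a b. n = a + b + 1 \<and> a \<noteq> 1 \<and> b \<noteq> 1 \<and> g = path_game a + path_game b)"
  proof -
    have "left_available (path_graph n) a \<longleftrightarrow> 4 \<le> n \<and> a \<noteq> 1 \<and> b \<noteq> 1"
      "position (delete_vertex (path_graph n) a) = path_game a + path_game b"
      if n: "n = a + b + 1" for a b
      using left_safe_path_graph[of a b] position_two_paths[of a "a + 1" b]
      unfolding left_available_def n delete_vertex_path_graph
      by (auto simp: component_path_graph live_path_graph)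
    then have "n = a + b + 1 \<and> left_available (path_graph n) a \<and>
          g = position (delete_vertex (path_graph n) a) \<longleftrightarrow>
        4 \<le> n \<and> n = a + b + 1 \<and> a \<noteq> 1 \<and> b \<noteq> 1 \<and> g = path_game a + path_game b" for a b
      by (cases "n = a + b + 1") simp_all
    then show ?thesis by simp
  qed
  finally show ?thesis .
qed

lemma right_opts_path_game:
  "g |\<in>| right_opts (path_game n) \<longleftrightarrow>
    (\<exists>a b. n = a + b \<and> 2 \<le> a \<and> 2 \<le> b \<and> g = path_game a + path_game b)"
proof -
  have "g |\<in>| right_opts (path_game n) \<longleftrightarrow>
      (\<exists>e. e |\<in>| edges (path_graph n) \<and> right_available (path_graph n) e \<and>
        g = position (delete_edge (path_graph n) e))"
    by (subst position.simps) auto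
  also have "\<dots> \<longleftrightarrow> (\<exists>a b. n = a + b \<and> 1 \<le> a \<and> 1 \<le> b \<and>
      right_available (path_graph n) {|a - 1, Suc (a - 1)|} \<and>
      g = position (delete_edge (path_graph n) {|a - 1, Suc (a - 1)|}))"
  proof -
    have "{|a - 1, Suc (a - 1)|} |\<in>| edges (path_graph (a + b))" if "1 \<le> a" "1 \<le> b" for a b
      unfolding edges_path_graph using that by (intro exI[of _ "a - 1"]) simp
    then show ?thesis
      by (metis edge_path_graphE)
  qed
  also have "\<dots> \<longleftrightarrow> (\<exists>a b. n = a + b \<and> 2 \<le> a \<and> 2 \<le> b \<and> g = path_game a + path_game b)"
  proof -
    have "right_available (path_graph n) {|a - 1, Suc (a - 1)|} \<longleftrightarrow> 2 \<le> a \<and> 2 \<le> b"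
      "position (delete_edge (path_graph n) {|a - 1, Suc (a - 1)|}) = path_game a + path_game b"
      if n: "n = a + b" and ab: "1 \<le> a" "1 \<le> b" for a b
    proof -
      show "right_available (path_graph n) {|a - 1, Suc (a - 1)|} \<longleftrightarrow> 2 \<le> a \<and> 2 \<le> b"
        using right_safe_path_graph[OF ab] ab component_path_graph[of a "a + b"]
          live_path_graph[of "a + b"]
        unfolding right_available_def n by auto
      show "position (delete_edge (path_graph n) {|a - 1, Suc (a - 1)|}) = path_game a + path_game b"
        unfolding n delete_edge_path_graph[OF ab] by (rule position_two_paths) simp
    qed
    then have "n = a + b \<and> 1 \<le> a \<and> 1 \<le> b \<and>
          right_available (path_graph n) {|a - 1, Suc (a - 1)|} \<and>
          g = position (delete_edge (path_graph n) {|a - 1, Suc (a - 1)|}) \<longleftrightarrow>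
        n = a + b \<and> 2 \<le> a \<and> 2 \<le> b \<and> g = path_game a + path_game b" for a b
      by (cases "n = a + b \<and> 1 \<le> a \<and> 1 \<le> b") auto
    then show ?thesis by simp
  qed
  finally show ?thesis .
qed

section \<open>Atomic weights of paths\<close>

lemma path_game_less_4:
  assumes "n < 4"
  shows "path_game n = 0"
proof (rule game_eqI)
  show "left_opts (path_game n) = left_opts 0"
    using assms by (intro fset_eqI; unfold left_opts_path_game) simp
  show "right_opts (path_game n) = right_opts 0"
    using assms by (intro fset_eqI; unfold right_opts_path_game) auto
qed

text \<open>Either player can only reach sums of paths with at most three vertices, all equal to
  0.\<close>

lemma path_game_4: "path_game 4 = nim 1"
proof (rule game_eqI)
  have "(\<exists>a b. 4 = a + b + 1 \<and> a \<noteq> 1 \<and> b \<noteq> 1 \<and> g = path_game a + path_game b) \<longleftrightarrow> g = 0" for g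
  proof
    assume "\<exists>a b. 4 = a + b + 1 \<and> a \<noteq> 1 \<and> b \<noteq> 1 \<and> g = path_game a + path_game b"
    then obtain a b where ab: "4 = a + b + 1" "g = path_game a + path_game b"
      by blast
    then have "a < 4" "b < 4" by simp_all
    then show "g = 0" by (simp add: ab path_game_less_4)
  next
    assume "g = 0"
    then show "\<exists>a b. 4 = a + b + 1 \<and> a \<noteq> 1 \<and> b \<noteq> 1 \<and> g = path_game a + path_game b"
      by (intro exI[of _ 0] exI[of _ 3]) (simp add: path_game_less_4)
  qed
  then show "left_opts (path_game 4) = left_opts (nim 1)"
    by (intro fset_eqI; unfold left_opts_path_game) simp
  have "(\<exists>a b. 4 = a + b \<and> 2 \<le> a \<and> 2 \<le> b \<and> g = path_game a + path_game b) \<longleftrightarrow> g = 0" for g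
  proof
    assume "\<exists>a b. 4 = a + b \<and> 2 \<le> a \<and> 2 \<le> b \<and> g = path_game a + path_game b"
    then obtain a b where ab: "4 = a + b" "2 \<le> a" "2 \<le> b" "g = path_game a + path_game b"
      by blast
    then have "a < 4" "b < 4" by simp_all
    then show "g = 0" by (simp add: ab path_game_less_4)
  next
    assume "g = 0"
    then show "\<exists>a b. 4 = a + b \<and> 2 \<le> a \<and> 2 \<le> b \<and> g = path_game a + path_game b"
      by (intro exI[of _ 2]) (simp add: path_game_less_4)
  qed
  then show "right_opts (path_game 4) = right_opts (nim 1)"
    by (intro fset_eqI; unfold right_opts_path_game) simp
qed

lemma path_game_left_wins:
  assumes "4 \<le> a + b + 1" "a \<noteq> 1" "b \<noteq> 1" "n = a + b + 1"
    and "0 \<le> val (path_game a) + val (path_game b) + nv j"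
  shows "\<not> val (path_game n) + nv j \<le> 0"
  using assms by (intro fuzzy_left_plusI[of "path_game a + path_game b" _ _ "nim j"])
    (auto simp only: left_opts_path_game val_plus)

lemma path_game_nonneg:
  assumes "\<And>a b. n = a + b \<Longrightarrow> 2 \<le> a \<Longrightarrow> a \<le> b \<Longrightarrow> \<not> val (path_game a) + val (path_game b) + nv j \<le> 0"
    and "\<And>i. i < j \<Longrightarrow> \<not> val (path_game n) + nv i \<le> 0"
  shows "0 \<le> val (path_game n) + nv j"
proof -
  have "\<not> val (path_game a) + val (path_game b) + nv j \<le> 0" if "n = a + b" "2 \<le> a" "2 \<le> b" for a b
    using assms(1)[of a b] assms(1)[of b a] that
    by (metis add.commute nat_le_linear)
  then have "\<not> val g + nv j \<le> 0" if "g |\<in>| right_opts (path_game n)" for g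
    using that unfolding right_opts_path_game by (metis val_plus)
  then show ?thesis
    unfolding nonneg_plus_nv_iff[of "path_game n"] using assms(2) by blast
qed

text \<open>The heap sizes 0 and 1 have to be treated separately: \<open>path_game 5\<close> has value \<open>up + star\<close>,
  which is not \<open>\<ge> 0\<close>, and \<open>path_game 8\<close> is confused with both \<open>0\<close> and \<open>star\<close>.\<close>

lemma path_game_atomic_weight: "has_atomic_weight (path_game n) (int ((n - 1) div 4))"
    and path_game_first: "5 \<le> n \<Longrightarrow> \<not> val (path_game n) + nv j \<le> 0"
    and path_game_second: "5 \<le> n \<Longrightarrow> 2 \<le> j \<Longrightarrow> 0 \<le> val (path_game n) + nv j"
proof -
  have "has_atomic_weight (path_game n) (int ((n - 1) div 4)) \<and>
    (5 \<le> n \<longrightarrow> (\<forall>j. \<not> val (path_game n) + nv j \<le> 0) \<and>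
      (\<forall>j\<ge>2. 0 \<le> val (path_game n) + nv j)) \<and>
    (n = 7 \<or> 9 \<le> n \<longrightarrow> 0 \<le> val (path_game n) + nv 0) \<and>
    (n = 5 \<longrightarrow> 0 \<le> val (path_game n) + nv 1)"
  proof (induction n rule: less_induct)
    case (less n)
    note small = path_game_less_4 path_game_4
    show ?case
    proof (cases "n < 5")
      case True
      then consider "n < 4" | "n = 4" by linarith
      then have "has_atomic_weight (path_game n) 0"
        by cases (use has_atomic_weight_nim[of 0] has_atomic_weight_nim[of 1] in
          \<open>simp_all only: small nim_0\<close>)
      moreover have "(n - 1) div 4 = 0"
        using True by simp
      ultimately show ?thesis
        using True by simp
    next
      case False
      then have n: "5 \<le> n" by simp
      let ?p = "\<lambda>n. val (path_game n)"
      have sum: "has_atomic_weight (path_game a + path_game b) (int ((a - 1) div 4 + (b - 1) div 4))"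
        if "a < n" "b < n" for a b
        using has_atomic_weight_plus less that by (metis of_nat_add)
      \<comment> \<open>A piece with at least five vertices has positive weight, so Left can answer
        this cut beside any heap. Only cuts into pieces of at most four vertices remain to be
        inspected.\<close>
      have ahead: "\<not> ?p a + ?p b + nv j \<le> 0" if "n = a + b" "2 \<le> a" "a \<le> b" "5 \<le> b" for a b j
      proof -
        have "0 < int ((a - 1) div 4 + (b - 1) div 4)"
          using that by simp
        from one_ahead[OF sum this] show ?thesis
          using that by simp
      qed
      have zero: "0 \<le> ?p n + nv 0" if "n = 7 \<or> 9 \<le> n"
      proof (rule path_game_nonneg)
        fix a b
        assume ab: "n = a + b" "2 \<le> a" "a \<le> b"
        show "\<not> ?p a + ?p b + nv 0 \<le> 0"
        proof (cases "5 \<le> b")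
          \<comment> \<open>Only \<open>n = 7\<close> admits such a cut here, and it leaves
            \<open>star\<close>.\<close>
          case False
          with ab that have "a = 3" "b = 4" by auto
          then show ?thesis
            using nv_fuzzy[of 1] by (simp add: small)
        qed (use ab ahead in blast)
      qed simp
      \<comment> \<open>Every cut of P_5 leaves 0 beside the heap \<open>star\<close>; if Right
        removes the heap instead, Left deletes the middle vertex.\<close>
      have five: "0 \<le> ?p n + nv 1" if n5: "n = 5"
      proof (rule path_game_nonneg)
        fix a b
        assume "n = a + b" "2 \<le> a" "a \<le> b"
        with n5 have "a < 4" "b < 4" by auto
        then show "\<not> ?p a + ?p b + nv 1 \<le> 0"
          using nv_fuzzy[of 1] by (simp add: small)
      next
        fix i :: nat
        assume "i < 1"
        then show "\<not> ?p n + nv i \<le> 0"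
          using n5 by (intro path_game_left_wins[of 2 2]) (simp_all add: small)
      qed
      have first: "\<not> ?p n + nv j \<le> 0" for j
      proof -
        \<comment> \<open>Left has three kinds of opening: reduce the heap to one where she wins as
          second player, delete an end vertex, or reach value exactly 0.\<close>
        have heap: ?thesis if "i < j" "0 \<le> ?p n + nv i" for i
          using fuzzy_left_plusI[OF nim_optI(1)[OF that(1)] _ refl, of "path_game n"] that(2)
          by (metis add.commute)
        have shorten: ?thesis if "0 \<le> ?p (n - 1) + nv j"
          using n that by (intro path_game_left_wins[of "n - 1" 0]) (simp_all add: small)
        have split: ?thesis if "n = a + b + 1" "a \<noteq> 1" "b \<noteq> 1" "?p a + ?p b + nv j = 0" for a b
          using n that by (intro path_game_left_wins[of a b]) simp_all
        have "j = 0 \<or> j = 1 \<or> 2 \<le> j" "n = 5 \<or> n = 6 \<or> n = 7 \<or> n = 8 \<or> n = 9 \<or> 10 \<le> n"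
          using n by linarith+
        then consider "2 \<le> j" "n = 5" | "2 \<le> j" "6 \<le> n"
          | "j = 0" "n = 5" | "j = 0" "n = 6" | "j = 0" "n = 7" | "j = 0" "n = 9"
          | "j = 0" "n = 8 \<or> 10 \<le> n"
          | "j = 1" "n = 5" | "j = 1" "n = 6" | "j = 1" "n = 8" | "j = 1" "n = 7 \<or> 9 \<le> n"
          by (elim disjE) simp_all
        then show ?thesis
        proof cases
          case 1
          then show ?thesis using heap[of 1] five by simp
        next
          case 2
          have "n - 1 < n" "5 \<le> n - 1"
            using 2 by simp_all
          then show ?thesis using shorten less 2(1) by blast
        next
          case 3
          then show ?thesis by (intro split[of 2 2]) (simp_all add: small)
        next
          case 4
          then show ?thesis by (intro split[of 2 3]) (simp_all add: small)
        next
          case 5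
          then show ?thesis by (intro split[of 3 3]) (simp_all add: small)
        next
          \<comment> \<open>Shortening would leave P_8, which Right wins moving first by cutting it
            in half. Deleting the middle vertex leaves two copies of \<open>star\<close>
            instead.\<close>
          case 6
          then show ?thesis by (intro split[of 4 4]) (simp_all add: small)
        next
          case 7
          then have "n - 1 < n" "n - 1 = 7 \<or> 9 \<le> n - 1"
            by auto
          then show ?thesis using shorten less 7(1) by blast
        next
          case 8
          then show ?thesis by (intro split[of 4 0]) (simp_all add: small)
        next
          case 9
          then have "n - 1 < n" "n - 1 = 5"
            by auto
          then show ?thesis using shorten less 9(1) by blast
        next
          \<comment> \<open>Removing the heap would again leave P_8 with Right to move; pieces of 3
            and 4 vertices leave a \<open>star\<close> that cancels the heap.\<close>
          case 10
          then show ?thesis by (intro split[of 3 4]) (simp_all add: small)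
        next
          case 11
          then show ?thesis using heap[of 0] zero by simp
        qed
      qed
      have second: "0 \<le> ?p n + nv j" if j: "2 \<le> j" for j
      proof (rule path_game_nonneg)
        fix a b
        assume ab: "n = a + b" "2 \<le> a" "a \<le> b"
        show "\<not> ?p a + ?p b + nv j \<le> 0"
        proof (cases "5 \<le> b")
          case False
          \<comment> \<open>These cuts are worth 0 or \<open>star\<close>, and neither cancels a
            heap of size at least 2.\<close>
          with ab consider "a < 4" "b < 4" | "a < 4" "b = 4" | "a = 4" "b = 4" by linarith
          then show ?thesis
            by cases (use nv_fuzzy[of j] nv_sum_fuzzy(1)[of 1 j] j in \<open>simp_all add: small\<close>)
        qed (use ab ahead in blast)
      qed (rule first)
      have "has_atomic_weight (path_game n) (int ((n - 1) div 4))"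
      proof (rule has_atomic_weight_step)
        show "1 \<le> int ((n - 1) div 4)"
          using n by simp
      next
        fix R
        assume "R |\<in>| right_opts (path_game n)"
        then obtain a b where ab: "n = a + b" "2 \<le> a" "2 \<le> b" "R = path_game a + path_game b"
          by (auto simp: right_opts_path_game)
        \<comment> \<open>With remainders \<open>r\<close> and \<open>s\<close> of
          \<open>a - 1\<close> and \<open>b - 1\<close> modulo 4, \<open>n - 1\<close> has
          \<open>r + s + 1 \<le> 7\<close> beyond the full multiples of 4, so a cut loses at most
          one.\<close>
        then have "int ((n - 1) div 4) - 1 \<le> int ((a - 1) div 4 + (b - 1) div 4)"
          by linarith
        with ab sum[of a b] show "\<exists>r\<ge>int ((n - 1) div 4) - 1. has_atomic_weight R r"
          by auto
      next
        \<comment> \<open>Cutting off P_4 loses exactly one. For \<open>n = 5\<close> that would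
          isolate a vertex, so the pieces are P_2 and P_3.\<close>
        have "\<exists>a b. n = a + b \<and> 2 \<le> a \<and> 2 \<le> b \<and> (a - 1) div 4 + (b - 1) div 4 + 1 = (n - 1) div 4"
        proof (cases "n = 5")
          case True
          then show ?thesis by (intro exI[of _ 2] exI[of _ 3]) simp
        next
          case False
          with n obtain m where m: "n = 4 + (m + 2)"
            using that[of "n - 6"] by simp
          have "(4 - 1) div 4 + (m + 2 - 1) div 4 + 1 = (n - 1) div (4 :: nat)"
            unfolding m using div_add_self1[of 4 "m + 1"] by simp
          moreover have "2 \<le> (4 :: nat)" "2 \<le> m + 2" by simp_all
          ultimately show ?thesis using m by blast
        qed
        then obtain a b where ab: "n = a + b" "2 \<le> a" "2 \<le> b"
          "(a - 1) div 4 + (b - 1) div 4 + 1 = (n - 1) div 4" by blast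
        then have "int ((n - 1) div 4) - 1 = int ((a - 1) div 4 + (b - 1) div 4)"
          by linarith
        moreover have "has_atomic_weight (path_game a + path_game b) (int ((a - 1) div 4 + (b - 1) div 4))"
          using ab(1-3) by (intro sum) simp_all
        moreover have "path_game a + path_game b |\<in>| right_opts (path_game n)"
          using ab(1-3) unfolding right_opts_path_game by blast
        ultimately show "\<exists>R. R |\<in>| right_opts (path_game n) \<and>
            has_atomic_weight R (int ((n - 1) div 4) - 1)"
          by metis
      next
        fix L
        assume "L |\<in>| left_opts (path_game n)"
        then obtain a b where ab: "n = a + b + 1" "L = path_game a + path_game b"
          by (auto simp: left_opts_path_game)
        \<comment> \<open>Truncated subtraction assigns weight 0 to the empty path, which arises
          when an end vertex is deleted.\<close>
        then have "int ((a - 1) div 4 + (b - 1) div 4) \<le> int ((n - 1) div 4) + 1"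
          by linarith
        with ab sum[of a b] show "\<exists>l\<le>int ((n - 1) div 4) + 1. has_atomic_weight L l"
          by auto
      qed (rule first)
      with first second zero five show ?thesis by blast
    qed
  qed
  then show "has_atomic_weight (path_game n) (int ((n - 1) div 4))"
    "5 \<le> n \<Longrightarrow> \<not> val (path_game n) + nv j \<le> 0"
    "5 \<le> n \<Longrightarrow> 2 \<le> j \<Longrightarrow> 0 \<le> val (path_game n) + nv j"
    by blast+
qed

theorem theorem3p16:
  fixes n :: nat
  assumes "n \<ge> 5"
  shows "greater_far_star (position (path_graph n)) \<and>
    (\<exists>!k. has_atomic_weight (position (path_graph n)) k) \<and>
    atomic_weight (position (path_graph n)) \<ge> 1"
proof (intro conjI)
  show "greater_far_star (path_game n)"
    unfolding greater_far_star_def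
  proof (rule eventually_sequentiallyI)
    fix m :: nat
    assume "2 \<le> m"
    with assms have "0 \<le> val (path_game n) - nv m" "\<not> val (path_game n) - nv m \<le> 0"
      using path_game_first path_game_second by simp_all
    then show "nim m < path_game n"
      unfolding less_le_not_le val_le[symmetric] by (simp only: diff_ge_0_iff_ge diff_le_0_iff_le simp_thms)
  qed
  \<comment> \<open>\<open>atomic_weight\<close> is a definite description, so uniqueness is needed
    to evaluate it.\<close>
  show unique: "\<exists>!k. has_atomic_weight (path_game n) k"
    using path_game_atomic_weight has_atomic_weight_unique by blast
  then have "atomic_weight (path_game n) = int ((n - 1) div 4)"
    unfolding atomic_weight_def by (rule the1_equality) (rule path_game_atomic_weight)
  with assms show "1 \<le> atomic_weight (path_game n)"
    by simp
qed

end
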